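(* Let $w\ge 4$, $u=w-2$, $v=w-1$, let $\sum$ denote the sum over positive integers $a,b,c$ with $a+b+c=w$, and write $\tilde a=a-1$, $\tilde b=b-1$. Then, as identities of polynomials in $T$, \begin{align*} 2\sum 3^{\tilde a}2^{\tilde b}\zeta_\sqcup(a,b,c)&=\Big(\tfrac13\tbinom{v}{2}+u\Big)\zeta(w)+2\zeta_*(1,1,u)-2\zeta(u,2)+w\zeta_*(1,v),\\ 2\sum 3^{\tilde a}2^{\tilde b}\big(\zeta_\sqcup(a,\bar b,c)+\zeta(\bar a,b,\bar c)+\zeta(\bar a,\bar b,\bar c)\big)&=2\zeta(\bar1,1,u)+2\zeta_*(1,\bar1,u)+2\zeta(\bar1,\bar1,u)+\tbinom{v}{2}\zeta(w)+2\zeta(\bar1,v)\\ &\quad+2\zeta_*(1,\bar v)+2\zeta(\bar1,\bar v)-2\zeta(u,2)-4\zeta(u,\bar2)\\ &\quad+u\big(2\zeta(\bar1,v)+2\zeta(\bar w)+\zeta(w)+\zeta_*(1,v)\big),\\ 2\sum 3^{\tilde a}2^{\tilde b}\big(\zeta_\sqcup(a,\bar b,\bar c)+\zeta_\sqcup(a,b,\bar c)+\zeta(\bar a,\bar b,c)\big)&=2\zeta_*(1,1,\bar u)+2\zeta_*(1,\bar1,\bar u)+2\zeta(\bar1,1,\bar u)+2\zeta_*(1,\bar v)+2\zeta(\bar1,\bar v)\\ &\quad+2\zeta_*(1,v)+\zeta(\bar2,\bar u)-\zeta(2,\bar u)-4\zeta(\bar u,2)-2\zeta(\bar u,\bar2)\\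 &\quad+u\big(2\zeta_*(1,\bar v)+\zeta(\bar1,\bar v)+\zeta(w)+2\zeta(\bar w)\big)+\tbinom{v}{2}\zeta(\bar w)+\zeta(w)-\zeta(\bar w),\\ 2\sum 3^{\tilde a}2^{\tilde b}\zeta(\bar a,b,c)&=2\zeta(\bar1,\bar1,\bar u)+u\zeta(\bar1,\bar v)+2\zeta(\bar1,v)+\zeta(2,\bar u)-2\zeta(\bar u,\bar2)-\zeta(\bar2,\bar u)\\ &\quad+\Big(\tfrac13\tbinom{v}{2}+1\Big)\zeta(\bar w)+(w-3)\zeta(w). \end{align*}
   Context: Euler sums: for positive integers $s_j$ and $z_j\in\{\pm1\}$, $\zeta(s_1,\dots,s_d;z_1,\dots,z_d)=\sum_{n_1>\dots>n_d>0}\frac{z_1^{n_1}\cdots z_d^{n_d}}{n_1^{s_1}\cdots n_d^{s_d}}$, convergent iff $(s_1,z_1)\ne(1,1)$; a bar over the $j$-th argument means $z_j=-1$, no bar means $z_j=1$. Regularized values: the truncated sum $\zeta^{(M)}$ (restricted to $M\ge n_1$) has, as $M\to\infty$, an expansion $P(\log M+\gamma)+o(1)$ with $P$ a polynomial ($\gamma$ Euler's constant); $\zeta_*:=P(T)\in\mathbb{R}[T]$. With $a_k=\prod_{j\le k}z_j$, $\int_0^{1-\varepsilon}\left(\frac{dt}{t}\right)^{s_1-1}\frac{dt}{a_1-t}\cdots\left(\frac{dt}{t}\right)^{s_d-1}\frac{dt}{a_d-t}$ (iterated integral over $1-\varepsilon>t_1>t_2>\dots>0$, forms read left to right) has, as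 $\varepsilon\to0^+$, an expansion $Q(-\log\varepsilon)+o(1)$; $\zeta_\sqcup:=Q(T)$. Both equal the Euler sum for convergent indices. *)

theory Defs
  imports "HOL-Analysis.Analysis" "HOL-Computational_Algebra.Polynomial"
begin

text \<open>An index of an Euler sum is a list of pairs (s_j, bar_j); bar_j = True means z_j = -1.\<close>

definition zsgn :: "bool \<Rightarrow> real" where
  "zsgn b = (if b then -1 else 1)"

fun esum_trunc :: "(nat \<times> bool) list \<Rightarrow> nat \<Rightarrow> real" where
  "esum_trunc [] M = 1"
| "esum_trunc ((s, b) # rest) M =
     (\<Sum>n\<in>{1..M}. zsgn b ^ n / real n ^ s * esum_trunc rest (n - 1))"

definition euler_zeta :: "(nat \<times> bool) list \<Rightarrow> real" where
  "euler_zeta idx = lim (\<lambda>M. esum_trunc idx M)"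

definition zc :: "(nat \<times> bool) list \<Rightarrow> real poly" where
  "zc idx = [:euler_zeta idx:]"

definition zeta_st :: "(nat \<times> bool) list \<Rightarrow> real poly" where
  "zeta_st idx = (THE P. ((\<lambda>M. esum_trunc idx M - poly P (ln (real M) + euler_mascheroni))
                          \<longlonglongrightarrow> 0))"

definition form :: "real \<Rightarrow> real \<Rightarrow> real" where
  "form a t = (if a = 0 then 1 / t else 1 / (a - t))"

text \<open>Word of letters: (dt/t)^(s_j-1) dt/(a_j - t), with a_k = z_1 \<cdots> z_k.\<close>
fun word_aux :: "real \<Rightarrow> (nat \<times> bool) list \<Rightarrow> real list" where
  "word_aux a [] = []"
| "word_aux a ((s, b) # rest) =
     replicate (s - 1) 0 @ [a * zsgn b] @ word_aux (a * zsgn b) rest"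

definition word :: "(nat \<times> bool) list \<Rightarrow> real list" where
  "word idx = word_aux 1 idx"

primrec iter_int :: "real list \<Rightarrow> real \<Rightarrow> real" where
  "iter_int [] = (\<lambda>x. 1)"
| "iter_int (a # as) = (\<lambda>x. integral {0..x} (\<lambda>t. form a t * iter_int as t))"

definition zeta_sh :: "(nat \<times> bool) list \<Rightarrow> real poly" where
  "zeta_sh idx = (THE Q. ((\<lambda>\<epsilon>. iter_int (word idx) (1 - \<epsilon>) - poly Q (- ln \<epsilon>))
                          \<longlongrightarrow> 0) (at_right 0))"

definition comps3 :: "nat \<Rightarrow> (nat \<times> nat \<times> nat) set" where
  "comps3 w = {(a, b, c). a \<ge> 1 \<and> b \<ge> 1 \<and> c \<ge> 1 \<and> a + b + c = w}"

end

theory Submission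
  imports Defs
begin

text \<open>
  Multiply three polylogarithms \<open>Li\<^sub>p(z\<^sub>1 x)\<close>, \<open>Li\<^sub>q(z\<^sub>2 x)\<close>, \<open>Li\<^sub>r(z\<^sub>3 x)\<close> with \<open>z\<^sub>i = \<plusminus>1\<close> and sum over
  \<open>p + q + r = w\<close>. Differentiating in \<open>x\<close> shows that the result is the sum, over all orderings of
  the letters, of the iterated integrals weighted by \<open>3\<^sup>a\<^sup>-\<^sup>1 2\<^sup>b\<^sup>-\<^sup>1\<close>. For truncated sums, the same
  product is summed over \<open>p + q + r = w\<close> by partial fractions: for distinct \<open>l, m, n\<close> one obtains
  \<open>l\<^sup>-\<^sup>u / ((m - l) (n - l))\<close> and its two companions. The inner sums over \<open>m\<close> and \<open>n\<close> are
  differences of partial sums of \<open>\<Sum> z\<^sup>k / k\<close>, which are again nested sums up to an error that vanishes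
  in the limit. Both regularizations are multiplicative and agree in depth 1, so the two
  evaluations of the product coincide as polynomials; the four identities are the sign patterns
  \<open>+++\<close>, \<open>--+\<close>, \<open>++-\<close> and \<open>---\<close>.
\<close>

text \<open>Reading a word from its outermost form explains the weights: while all three factors are
  present, a form dt/t can come from any of them, which gives \<open>3 ^ (a - 1)\<close>; once one
  factor has ended in its letter two are left, then one. The detour through depth 1 is forced by the
  regularizations: already for the index (1,1) the iterated integral gives T^2/2 and the truncated
  sum (T^2 - zeta(2))/2, so a direct comparison at higher depth would need correction terms. The
  analytic obstacle is the shape of the truncation. The sum over m \<le> M of z^m/(m - l) is centred
  at l, so its right half has cut-off M - l instead of M, and the truncated product is not exactly a
  combination of nested sums with cut-off M. The discrepancy is harmless because it is weighted by
  l^(-u) with u \<ge> 2; for weight 1/l the bounding sum would tend to zeta(2) instead of 0.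
  Coincident summation indices contribute separately, and the case of all three equal is where the
  binomial coefficient comes from.\<close>

section \<open>Polynomial asymptotics\<close>

text \<open>The error has to decay faster than every power of \<open>\<rho>\<close>, which makes the relation multiplicative.\<close>

definition asymp_poly :: "'a filter \<Rightarrow> ('a \<Rightarrow> real) \<Rightarrow> ('a \<Rightarrow> real) \<Rightarrow> real poly \<Rightarrow> bool" where
  "asymp_poly F \<rho> f P \<longleftrightarrow> (\<forall>p. ((\<lambda>t. poly p (\<rho> t) * (f t - poly P (\<rho> t))) \<longlongrightarrow> 0) F)"

lemma asymp_polyD: "asymp_poly F \<rho> f P \<Longrightarrow> ((\<lambda>t. f t - poly P (\<rho> t)) \<longlongrightarrow> 0) F"
  unfolding asymp_poly_def by (drule spec[of _ 1]) simp

lemma asymp_poly_add: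
  assumes "asymp_poly F \<rho> f P" "asymp_poly F \<rho> g Q"
  shows "asymp_poly F \<rho> (\<lambda>t. f t + g t) (P + Q)"
  unfolding asymp_poly_def
proof
  fix p
  have "((\<lambda>t. poly p (\<rho> t) * (f t - poly P (\<rho> t)) + poly p (\<rho> t) * (g t - poly Q (\<rho> t))) \<longlongrightarrow> 0 + 0) F"
    using assms unfolding asymp_poly_def by (intro tendsto_add) auto
  thus "((\<lambda>t. poly p (\<rho> t) * (f t + g t - poly (P + Q) (\<rho> t))) \<longlongrightarrow> 0) F"
    by (simp add: algebra_simps)
qed

text \<open>The error fg - PQ equals (f - P)(g - Q) + P(g - Q) + Q(f - P). The last two terms carry
  polynomial factors, and these are absorbed by the multiplier \<open>p\<close> that the relation
  quantifies over.\<close>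

lemma asymp_poly_mult:
  assumes f: "asymp_poly F \<rho> f P" and g: "asymp_poly F \<rho> g Q"
  shows "asymp_poly F \<rho> (\<lambda>t. f t * g t) (P * Q)"
  unfolding asymp_poly_def
proof
  fix p
  have *: "((\<lambda>t. poly q (\<rho> t) * (f t - poly P (\<rho> t))) \<longlongrightarrow> 0) F"
          "((\<lambda>t. poly q (\<rho> t) * (g t - poly Q (\<rho> t))) \<longlongrightarrow> 0) F" for q
    using f g unfolding asymp_poly_def by auto
  have "((\<lambda>t. (poly p (\<rho> t) * (f t - poly P (\<rho> t))) * (poly 1 (\<rho> t) * (g t - poly Q (\<rho> t)))
      + poly (p * P) (\<rho> t) * (g t - poly Q (\<rho> t))
      + poly (p * Q) (\<rho> t) * (f t - poly P (\<rho> t))) \<longlongrightarrow> 0 * 0 + 0 + 0) F"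
    by (intro tendsto_intros *)
  thus "((\<lambda>t. poly p (\<rho> t) * (f t * g t - poly (P * Q) (\<rho> t))) \<longlongrightarrow> 0) F"
    by (simp add: algebra_simps)
qed

lemma asymp_poly_const: "asymp_poly F \<rho> (\<lambda>t. c) [:c:]"
  unfolding asymp_poly_def by simp

lemma asymp_poly_smult:
  "asymp_poly F \<rho> f P \<Longrightarrow> asymp_poly F \<rho> (\<lambda>t. c * f t) (smult c P)"
  using asymp_poly_mult[OF asymp_poly_const[of F \<rho> c]] by fastforce

lemma asymp_poly_diff:
  assumes "asymp_poly F \<rho> f P" "asymp_poly F \<rho> g Q"
  shows "asymp_poly F \<rho> (\<lambda>t. f t - g t) (P - Q)"
  using asymp_poly_add[OF assms(1) asymp_poly_smult[OF assms(2), of "- 1"]] by simp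

lemma asymp_poly_of_nat: "asymp_poly F \<rho> (\<lambda>_. of_nat n) (of_nat n)"
  using asymp_poly_const[of F \<rho> "of_nat n"] by (simp add: of_nat_poly)

lemma asymp_poly_numeral: "asymp_poly F \<rho> (\<lambda>_. numeral n) (numeral n)"
  using asymp_poly_const[of F \<rho> "numeral n"] by (simp add: numeral_poly)

lemma asymp_poly_sum:
  "(\<And>i. i \<in> A \<Longrightarrow> asymp_poly F \<rho> (f i) (P i)) \<Longrightarrow>
   asymp_poly F \<rho> (\<lambda>t. \<Sum>i\<in>A. f i t) (\<Sum>i\<in>A. P i)"
  using asymp_poly_const[of F \<rho> 0]
  by (induction A rule: infinite_finite_induct) (auto intro: asymp_poly_add)

text \<open>If \<open>f\<close> agrees with the parameter \<open>\<rho>\<close> up to a negligible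
  error, a polynomial in \<open>f\<close> keeps its coefficients. With \<open>f = harm\<close> this
  carries expansions in harmonic numbers over to expansions in ln M + gamma.\<close>

lemma asymp_poly_poly:
  assumes "asymp_poly F \<rho> f [:0, 1:]"
  shows "asymp_poly F \<rho> (\<lambda>t. poly P (f t)) P"
proof (induction P)
  case 0
  show ?case using asymp_poly_const[of F \<rho> 0] by simp
next
  case (pCons a P)
  have "asymp_poly F \<rho> (\<lambda>t. a + f t * poly P (f t)) ([:a:] + [:0, 1:] * P)"
    by (intro asymp_poly_add asymp_poly_mult asymp_poly_const assms pCons.IH)
  thus ?case by simp
qed

lemma asymp_poly_cong:
  assumes "asymp_poly F \<rho> f P" "eventually (\<lambda>t. f t = g t) F"
  shows "asymp_poly F \<rho> g P"
  unfolding asymp_poly_def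
proof
  fix p
  have "((\<lambda>t. poly p (\<rho> t) * (f t - poly P (\<rho> t))) \<longlongrightarrow> 0) F"
    using assms(1) unfolding asymp_poly_def by auto
  moreover have "eventually (\<lambda>t. poly p (\<rho> t) * (f t - poly P (\<rho> t)) =
      poly p (\<rho> t) * (g t - poly P (\<rho> t))) F"
    using assms(2) by eventually_elim simp
  ultimately show "((\<lambda>t. poly p (\<rho> t) * (g t - poly P (\<rho> t))) \<longlongrightarrow> 0) F"
    by (rule Lim_transform_eventually)
qed

text \<open>Each factor y costs half of the available rate, because y \<le> (2/\<delta>)
  exp(\<delta> y/2); hence \<open>\<delta>\<close> is arbitrary in the induction on the
  polynomial.\<close>

lemma poly_bounded_by_exp:
  fixes p :: "real poly"
  assumes "\<delta> > 0"
  shows "\<exists>C\<ge>0. \<forall>y\<ge>0. \<bar>poly p y\<bar> \<le> C * exp (\<delta> * y)"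
  using assms
proof (induction p arbitrary: \<delta>)
  case 0
  show ?case by (rule exI[of _ 0]) simp
next
  case (pCons a p)
  have "\<delta> / 2 > 0" using pCons.prems by simp
  from pCons.IH[OF this] obtain C where C: "C \<ge> 0" "\<And>y. y \<ge> 0 \<Longrightarrow> \<bar>poly p y\<bar> \<le> C * exp (\<delta> / 2 * y)"
    by auto
  show ?case
  proof (intro exI[of _ "\<bar>a\<bar> + 2 / \<delta> * C"] conjI allI impI)
    show "0 \<le> \<bar>a\<bar> + 2 / \<delta> * C" using C(1) pCons.prems by simp
    fix y :: real assume y: "y \<ge> 0"
    have "\<delta> / 2 * y \<le> exp (\<delta> / 2 * y)"
      using exp_ge_add_one_self[of "\<delta> / 2 * y"] by linarith
    hence 1: "y \<le> 2 / \<delta> * exp (\<delta> / 2 * y)"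
      using pCons.prems by (simp add: field_simps)
    have "\<bar>y * poly p y\<bar> \<le> (2 / \<delta> * exp (\<delta> / 2 * y)) * (C * exp (\<delta> / 2 * y))"
      unfolding abs_mult using 1 C y pCons.prems by (intro mult_mono) auto
    also have "\<dots> = 2 / \<delta> * C * exp (\<delta> * y)"
      by (simp add: mult_exp_exp field_simps flip: exp_add)
    finally have "\<bar>y * poly p y\<bar> \<le> 2 / \<delta> * C * exp (\<delta> * y)" .
    moreover have "\<bar>a\<bar> \<le> \<bar>a\<bar> * exp (\<delta> * y)"
      using y pCons.prems by (simp add: mult_le_cancel_left1)
    ultimately show "\<bar>poly (pCons a p) y\<bar> \<le> (\<bar>a\<bar> + 2 / \<delta> * C) * exp (\<delta> * y)"
      by (simp add: algebra_simps)
  qed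
qed

text \<open>An error exp(-\<rho>/2) means M^(-1/2) for truncated sums and eps^(1/2) for iterated
  integrals, up to constants. Half of this decay pays for the polynomial multiplier, which is
  bounded at rate 1/4, and the other half still tends to 0.\<close>

lemma asymp_polyI_exp:
  assumes \<rho>: "filterlim \<rho> at_top F" and bnd: "eventually (\<lambda>t. \<bar>f t - poly P (\<rho> t)\<bar> \<le> C * exp (- \<rho> t / 2)) F"
  shows "asymp_poly F \<rho> f P"
  unfolding asymp_poly_def
proof
  fix p :: "real poly"
  obtain B where B: "B \<ge> 0" "\<And>y. y \<ge> 0 \<Longrightarrow> \<bar>poly p y\<bar> \<le> B * exp (1 / 4 * y)"
    using poly_bounded_by_exp[of "1/4" p] by auto
  have "eventually (\<lambda>t. \<rho> t \<ge> 0) F" using \<rho> by (simp add: filterlim_at_top)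
  with bnd have "eventually (\<lambda>t. norm (poly p (\<rho> t) * (f t - poly P (\<rho> t))) \<le> B * C * exp (- \<rho> t / 4)) F"
  proof eventually_elim
    case (elim t)
    have "norm (poly p (\<rho> t) * (f t - poly P (\<rho> t))) \<le> (B * exp (1 / 4 * \<rho> t)) * (C * exp (- \<rho> t / 2))"
      unfolding real_norm_def abs_mult using B elim by (intro mult_mono) auto
    also have "\<dots> = B * C * exp (- \<rho> t / 4)"
      by (simp add: algebra_simps flip: exp_add)
    finally show ?case .
  qed
  moreover have "((\<lambda>t. B * C * exp (- \<rho> t / 4)) \<longlongrightarrow> 0) F"
  proof -
    have "filterlim (\<lambda>t. - \<rho> t / 4) at_bot F"
      using filterlim_tendsto_neg_mult_at_bot[OF tendsto_const _ \<rho>, of "- (1 / 4)"] by simp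
    hence "((\<lambda>t. exp (- \<rho> t / 4)) \<longlongrightarrow> 0) F"
      using exp_at_bot filterlim_compose by blast
    thus ?thesis using tendsto_mult_right_zero by blast
  qed
  ultimately show "((\<lambda>t. poly p (\<rho> t) * (f t - poly P (\<rho> t))) \<longlongrightarrow> 0) F"
    by (rule Lim_null_comparison)
qed

section \<open>Uniqueness of polynomial asymptotics\<close>

lemma poly_tendsto_zero_imp_zero:
  fixes P :: "real poly"
  assumes \<rho>: "filterlim \<rho> at_top F" and F: "F \<noteq> bot" and lim: "((\<lambda>t. poly P (\<rho> t)) \<longlongrightarrow> 0) F"
  shows "P = 0"
proof (rule ccontr)
  assume "P \<noteq> 0"
  \<comment> \<open>The sign makes the leading coefficient positive, so that \<open>Q\<close>
    eventually stays above it and cannot tend to 0.\<close>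
  define Q where "Q = smult (sgn (lead_coeff P)) P"
  have lc: "lead_coeff Q > 0"
    using \<open>P \<noteq> 0\<close> by (auto simp: Q_def sgn_if not_less order.order_iff_strict)
  then obtain n where n: "\<And>x. x \<ge> n \<Longrightarrow> poly Q x \<ge> lead_coeff Q"
    using poly_pinfty_gt_lc by blast
  have "((\<lambda>t. sgn (lead_coeff P) * poly P (\<rho> t)) \<longlongrightarrow> 0) F"
    using tendsto_mult_right_zero[OF lim] by blast
  hence "((\<lambda>t. poly Q (\<rho> t)) \<longlongrightarrow> 0) F" by (simp add: Q_def)
  hence "eventually (\<lambda>t. poly Q (\<rho> t) < lead_coeff Q) F"
    using lc by (rule order_tendstoD)
  moreover have "eventually (\<lambda>t. \<rho> t \<ge> n) F" using \<rho> by (simp add: filterlim_at_top)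
  ultimately have "eventually (\<lambda>t. False) F"
    by eventually_elim (use n in force)
  thus False using F by (simp add: eventually_False)
qed

text \<open>Besides making the two regularized values well defined, this is how identities between
  them are obtained: two expansions of the same function, up to o(1), have the same
  polynomial.\<close>

lemma poly_asymptotics_unique:
  fixes P Q :: "real poly"
  assumes \<rho>: "filterlim \<rho> at_top F" and F: "F \<noteq> bot"
    and "((\<lambda>t. f t - poly P (\<rho> t)) \<longlongrightarrow> 0) F" "((\<lambda>t. f t - poly Q (\<rho> t)) \<longlongrightarrow> 0) F"
  shows "P = Q"
proof -
  have "((\<lambda>t. (f t - poly Q (\<rho> t)) - (f t - poly P (\<rho> t))) \<longlongrightarrow> 0 - 0) F"
    by (rule tendsto_diff[OF assms(4,3)])
  hence "((\<lambda>t. poly (P - Q) (\<rho> t)) \<longlongrightarrow> 0) F" by simp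
  from poly_tendsto_zero_imp_zero[OF \<rho> F this] show ?thesis by simp
qed

lemma filterlim_ln_plus_euler_mascheroni:
  "filterlim (\<lambda>M. ln (real M) + euler_mascheroni) at_top sequentially"
proof -
  have "filterlim (\<lambda>M. ln (real M)) at_top sequentially"
    using filterlim_compose[OF ln_at_top filterlim_real_sequentially] .
  thus ?thesis
    by (subst add.commute) (rule filterlim_tendsto_add_at_top[OF tendsto_const])
qed

lemma filterlim_minus_ln_at_right_0: "filterlim (\<lambda>\<epsilon>. - ln \<epsilon> :: real) at_top (at_right 0)"
  using ln_at_0 by (simp add: filterlim_uminus_at_bot)

lemma zeta_st_eqI:
  "((\<lambda>M. esum_trunc idx M - poly P (ln (real M) + euler_mascheroni)) \<longlonglongrightarrow> 0) \<Longrightarrow> zeta_st idx = P"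
  unfolding zeta_st_def
  by (rule the_equality) (use poly_asymptotics_unique[OF filterlim_ln_plus_euler_mascheroni] in auto)

lemma zeta_sh_eqI:
  "((\<lambda>\<epsilon>. iter_int (word idx) (1 - \<epsilon>) - poly Q (- ln \<epsilon>)) \<longlongrightarrow> 0) (at_right 0) \<Longrightarrow> zeta_sh idx = Q"
  unfolding zeta_sh_def
  by (rule the_equality) (use poly_asymptotics_unique[OF filterlim_minus_ln_at_right_0] in auto)

text \<open>A Cauchy criterion with an explicit rate. The hypothesis says that the intervals from D
  x - \<phi> x to D x + \<phi> x are nested, and L is the supremum of their left ends. The index
  type is a general linear order because the lemma serves both sequences and functions of a real
  variable.\<close>

lemma eventually_close_to_constant:
  fixes D \<phi> :: "'a::linorder \<Rightarrow> real"
  assumes D: "\<And>x y. a \<le> x \<Longrightarrow> x \<le> y \<Longrightarrow> \<bar>D y - D x\<bar> \<le> \<phi> x - \<phi> y"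
    and \<phi>: "\<And>x. a \<le> x \<Longrightarrow> \<phi> x \<ge> 0"
  shows "\<exists>L. \<forall>x\<ge>a. \<bar>D x - L\<bar> \<le> \<phi> x"
proof -
  have le: "D x - \<phi> x \<le> D y + \<phi> y" if "a \<le> x" "a \<le> y" for x y
    using D[of x y] D[of y x] \<phi>[of x] \<phi>[of y] that
    by (cases "x \<le> y") (fastforce simp: not_le)+
  define L where "L = (SUP x\<in>{a..}. D x - \<phi> x)"
  have "D x - \<phi> x \<le> L" if "a \<le> x" for x
    unfolding L_def using that le[of _ a] by (intro cSUP_upper bdd_aboveI2) auto
  moreover have "L \<le> D x + \<phi> x" if "a \<le> x" for x
    unfolding L_def using that le by (intro cSUP_least) auto
  ultimately have "\<forall>x\<ge>a. \<bar>D x - L\<bar> \<le> \<phi> x" by (force simp: abs_le_iff)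
  thus ?thesis ..
qed

section \<open>Asymptotics of truncated Euler sums\<close>

lemma zsgn_simps [simp]: "zsgn False = 1" "zsgn True = -1"
  by (auto simp: zsgn_def)

lemma abs_zsgn_power [simp]: "\<bar>zsgn b ^ n\<bar> = 1"
  by (cases b) (auto simp: power_abs)

lemma zsgn_neq: "zsgn (b \<noteq> c) = zsgn b * zsgn c"
  by (cases b; cases c) auto

lemma esum_trunc_0 [simp]: "esum_trunc (x # xs) 0 = 0"
  by (cases x) auto

lemma esum_trunc_Suc:
  "esum_trunc ((s, b) # rest) (Suc n) =
     esum_trunc ((s, b) # rest) n + zsgn b ^ Suc n / real (Suc n) ^ s * esum_trunc rest n"
  by simp

declare esum_trunc.simps(2) [simp del]

section \<open>Expansions of truncated sums in harmonic numbers\<close>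

lemma harm_le_ln: "harm n \<le> 1 + ln (real n + 1)"
proof (induction n)
  case (Suc n)
  show ?case
  proof (cases "n = 0")
    case False
    have "harm (Suc n) \<le> harm 1 + ln (real (Suc n))"
      using decseqD[OF decseq_harm_diff_ln, of 0 n] by (simp add: harm_expand)
    also have "\<dots> \<le> 1 + ln (real (Suc n) + 1)"
      by (auto simp: harm_expand)
    finally show ?thesis .
  qed (auto simp: harm_expand)
qed (auto simp: harm_expand)

lemma poly_harm_le_sqrt: "\<exists>C\<ge>0. \<forall>n. \<bar>poly P (harm n)\<bar> \<le> C * sqrt (real n + 1)"
proof -
  obtain C where C: "C \<ge> 0" "\<And>y. y \<ge> 0 \<Longrightarrow> \<bar>poly P y\<bar> \<le> C * exp (1 / 2 * y)"
    using poly_bounded_by_exp[of "1/2" P] by auto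
  have "\<bar>poly P (harm n)\<bar> \<le> (C * exp (1/2)) * sqrt (real n + 1)" for n
  proof -
    have "\<bar>poly P (harm n)\<bar> \<le> C * exp (1 / 2 * harm n)" by (rule C) (rule harm_nonneg)
    also have "\<dots> \<le> C * exp (1/2 * (1 + ln (real n + 1)))"
      using C(1) harm_le_ln[of n] by (intro mult_left_mono) auto
    also have "exp (1/2 * (1 + ln (real n + 1))) = exp (1/2) * sqrt (real n + 1)"
      by (simp add: distrib_left exp_add ln_sqrt[symmetric])
    finally show ?thesis by (simp add: mult.assoc)
  qed
  with C(1) show ?thesis by (intro exI[of _ "C * exp (1/2)"]) auto
qed

text \<open>Harmonic numbers replace ln M + gamma during the induction on the index because their
  increments are exactly 1/(n + 1), and so the case of a leading unbarred 1 becomes a discrete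
  integration. The shift in \<open>real n + 1\<close> makes the bound meaningful at n = 0 as
  well.\<close>

definition harm_asymp :: "(nat \<Rightarrow> real) \<Rightarrow> real poly \<Rightarrow> bool" where
  "harm_asymp E P \<longleftrightarrow> (\<exists>C. \<forall>n. \<bar>E n - poly P (harm n)\<bar> \<le> C / sqrt (real n + 1))"

lemma harm_asymp_le_sqrt:
  assumes "harm_asymp E P"
  shows "\<exists>C\<ge>0. \<forall>n. \<bar>E n\<bar> \<le> C * sqrt (real n + 1)"
proof -
  obtain B where B: "B \<ge> 0" "\<And>n. \<bar>poly P (harm n)\<bar> \<le> B * sqrt (real n + 1)"
    using poly_harm_le_sqrt by blast
  obtain C where C: "\<And>n. \<bar>E n - poly P (harm n)\<bar> \<le> C / sqrt (real n + 1)"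
    using assms unfolding harm_asymp_def by blast
  have "\<bar>E n\<bar> \<le> (B + \<bar>C\<bar>) * sqrt (real n + 1)" for n
  proof -
    have "C / sqrt (real n + 1) \<le> \<bar>C\<bar> / 1"
      by (intro frac_le) auto
    also have "\<dots> \<le> \<bar>C\<bar> * sqrt (real n + 1)"
      by (simp add: mult_le_cancel_left1)
    finally show ?thesis using B(2)[of n] C[of n] by (simp add: algebra_simps)
  qed
  thus ?thesis using B(1) by (intro exI[of _ "B + \<bar>C\<bar>"]) auto
qed

text \<open>Increments of order n^(-3/2) are summable with tails of order n^(-1/2). The tail
  estimate is made explicit by a telescoping majorant.\<close>

lemma harm_asymp_const_if_small_increments:
  assumes "\<And>n. \<bar>D (Suc n) - D n\<bar> \<le> C / ((real n + 1) * sqrt (real n + 1))"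
  shows "\<exists>L. harm_asymp D [:L:]"
proof -
  have "0 \<le> \<bar>D (Suc 0) - D 0\<bar>" by simp
  also have "\<dots> \<le> C" using assms[of 0] by simp
  finally have C: "C \<ge> 0" .
  \<comment> \<open>With a = sqrt(n + 1) and b = sqrt(n + 2) one has 1/a - 1/b = 1/(a b (a + b)).
    Since b \<le> 2a and a + b \<le> 3a, this is at least 1/(6 a^3), whence the factor 6.\<close>
  define \<phi> where "\<phi> n = 6 * C / sqrt (real n + 1)" for n
  have incr: "\<bar>D (Suc n) - D n\<bar> \<le> \<phi> n - \<phi> (Suc n)" for n
  proof -
    define a b where "a = sqrt (real n + 1)" and "b = sqrt (real n + 2)"
    have ab: "a > 0" "b > 0" "a \<le> b" "b \<le> 2 * a" and sq: "a * a = real n + 1" "b * b = a * a + 1"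
    proof -
      have "b \<le> sqrt (4 * (real n + 1))" unfolding b_def by (intro real_sqrt_le_mono) auto
      also have "\<dots> = 2 * a" unfolding a_def by (subst real_sqrt_mult) simp
      finally show "b \<le> 2 * a" .
    qed (auto simp: a_def b_def)
    have "(a + b) * b \<le> (3 * a) * (2 * a)" using ab by (intro mult_mono) auto
    hence "a * ((a + b) * b) \<le> a * (6 * (a * a))" using ab by (intro mult_left_mono) auto
    hence "1 / (6 * (a * a * a)) \<le> 1 / (a * ((a + b) * b))"
      using ab by (intro divide_left_mono) (auto simp: mult_ac)
    also have "\<dots> = (b - a) / (a * b)"
    proof -
      have "(b - a) * (a + b) = 1" using sq by (simp add: algebra_simps)
      hence "1 / (a * ((a + b) * b)) = ((b - a) * (a + b)) / ((a * b) * (a + b))" by (simp add: mult_ac)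
      thus ?thesis using ab by simp
    qed
    also have "\<dots> = 1 / a - 1 / b" using ab by (simp add: field_simps)
    finally have *: "1 / (a * a * a) \<le> 6 / a - 6 / b" by simp
    have "C / (a * a * a) \<le> C * (6 / a - 6 / b)"
      using mult_left_mono[OF * C] by simp
    moreover have "\<phi> n - \<phi> (Suc n) = C * (6 / a - 6 / b)"
      by (simp add: \<phi>_def a_def b_def algebra_simps)
    ultimately show ?thesis using assms[of n] sq(1) a_def by simp
  qed
  have "\<bar>D y - D x\<bar> \<le> \<phi> x - \<phi> y" if "x \<le> y" for x y
    using that
  proof (induction y rule: dec_induct)
    case (step n)
    thus ?case using incr[of n] by linarith
  qed simp
  moreover have "\<phi> x \<ge> 0" for x using C by (simp add: \<phi>_def)
  ultimately obtain L where "\<And>x. \<bar>D x - L\<bar> \<le> \<phi> x"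
    using eventually_close_to_constant[of 0 D \<phi>] by auto
  thus ?thesis unfolding harm_asymp_def \<phi>_def by auto
qed

lemma poly_abs_le:
  fixes p :: "real poly"
  shows "\<exists>q. \<forall>h\<ge>0. \<bar>poly p h\<bar> \<le> poly q h"
proof (induction p)
  case 0
  show ?case by (rule exI[of _ 0]) simp
next
  case (pCons a p)
  then obtain q where q: "\<And>h. h \<ge> 0 \<Longrightarrow> \<bar>poly p h\<bar> \<le> poly q h" by auto
  have "\<bar>poly (pCons a p) h\<bar> \<le> poly (pCons \<bar>a\<bar> q) h" if "h \<ge> 0" for h
  proof -
    have "\<bar>h * poly p h\<bar> \<le> h * poly q h"
      using that q[OF that] by (simp add: abs_mult mult_left_mono)
    thus ?thesis by simp
  qed
  thus ?case by blast
qed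

text \<open>For d = 1/(n + 1) and h = \<open>harm n\<close> this compares one increment of an
  antiderivative with d times its derivative. In the induction, a + xS(x) has remainder (h + d) X +
  d^2 S'(h), where X is the remainder of S.\<close>

lemma poly_taylor_bound:
  fixes R :: "real poly"
  shows "\<exists>q. \<forall>h\<ge>0. \<forall>d\<in>{0..1}. \<bar>poly R (h + d) - poly R h - d * poly (pderiv R) h\<bar> \<le> d ^ 2 * poly q h"
proof (induction R)
  case 0
  show ?case by (rule exI[of _ 0]) simp
next
  case (pCons a S)
  then obtain q where q: "\<And>h d. h \<ge> 0 \<Longrightarrow> d \<in> {0..1} \<Longrightarrow>
      \<bar>poly S (h + d) - poly S h - d * poly (pderiv S) h\<bar> \<le> d ^ 2 * poly q h" by blast
  obtain r where r: "\<And>h. h \<ge> 0 \<Longrightarrow> \<bar>poly (pderiv S) h\<bar> \<le> poly r h" using poly_abs_le by blast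
  show ?case
  proof (intro exI[of _ "pCons 0 q + q + r"] allI ballI impI)
    fix h d :: real assume hd: "h \<ge> 0" "d \<in> {0..1}"
    define X where "X = poly S (h + d) - poly S h - d * poly (pderiv S) h"
    have X: "\<bar>X\<bar> \<le> d ^ 2 * poly q h" using q[OF hd] by (simp add: X_def)
    have "\<bar>h * X\<bar> \<le> h * (d ^ 2 * poly q h)" using X hd by (simp add: abs_mult mult_left_mono)
    moreover have "\<bar>d * X\<bar> \<le> 1 * (d ^ 2 * poly q h)"
      unfolding abs_mult using hd X by (intro mult_mono) auto
    moreover have "\<bar>d ^ 2 * poly (pderiv S) h\<bar> \<le> d ^ 2 * poly r h"
      using r[OF hd(1)] by (simp add: abs_mult mult_left_mono)
    moreover have "poly (pCons a S) (h + d) - poly (pCons a S) h - d * poly (pderiv (pCons a S)) h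
        = h * X + d * X + d ^ 2 * poly (pderiv S) h"
      by (simp add: X_def pderiv_pCons algebra_simps power2_eq_square)
    ultimately show "\<bar>poly (pCons a S) (h + d) - poly (pCons a S) h - d * poly (pderiv (pCons a S)) h\<bar>
        \<le> d ^ 2 * poly (pCons 0 q + q + r) h"
      by (simp add: algebra_simps)
  qed
qed

lemma pderiv_sum: "pderiv (sum f A) = (\<Sum>i\<in>A. pderiv (f i))"
  by (induction A rule: infinite_finite_induct) (auto simp: pderiv_add)

lemma ex_antiderivative_poly: "\<exists>R. pderiv R = (Q :: real poly)"
proof
  show "pderiv (\<Sum>i\<le>degree Q. monom (coeff Q i / real (Suc i)) (Suc i)) = Q"
    by (simp add: pderiv_sum pderiv_monom poly_as_sum_of_monoms)
qed


lemma inverse_sqrt_Suc_le: "1 / sqrt (real n + 1) \<le> 2 / sqrt (real n + 2)"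
proof -
  have "sqrt (real n + 2) \<le> sqrt (4 * (real n + 1))" by (intro real_sqrt_le_mono) auto
  also have "\<dots> = 2 * sqrt (real n + 1)" by (subst real_sqrt_mult) simp
  finally show ?thesis by (simp add: field_simps)
qed

lemma sqrt_over_self: "x \<ge> 0 \<Longrightarrow> sqrt x / x = 1 / sqrt x"
  by (cases "x = 0") (auto simp: real_div_sqrt field_simps)

text \<open>This is the case of a leading barred 1. The hypotheses bound the terms only by a
  multiple of n^(-1/2), so convergence must come from cancellation between neighbours, which needs
  control of the increments of the inner sum \<open>E\<close>.\<close>

lemma harm_asymp_alternating:
  assumes B: "\<And>n. \<bar>E n\<bar> \<le> B * sqrt (real n + 1)" "B \<ge> 0"
    and C: "\<And>n. \<bar>E (Suc n) - E n\<bar> \<le> C / sqrt (real n + 1)" "C \<ge> 0"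
    and D: "D 0 = 0" "\<And>n. D (Suc n) - D n = (- 1) ^ Suc n / real (Suc n) * E n"
  shows "\<exists>L. harm_asymp D [:L:]"
proof -
  define a where "a n = E (n - 1) / real n" for n
  \<comment> \<open>Summation by parts: subtracting half of the last term makes the increments absolutely summable.\<close>
  define D' where "D' n = D n - (- 1) ^ n * a n / 2" for n
  have a_le: "\<bar>a n\<bar> \<le> 2 * B / sqrt (real n + 1)" for n
  proof (cases n)
    case 0
    thus ?thesis using B(2) by (simp add: a_def)
  next
    case (Suc k)
    have "\<bar>a n\<bar> = \<bar>E k\<bar> / (real k + 1)" using Suc by (simp add: a_def add.commute)
    also have "\<dots> \<le> B * sqrt (real k + 1) / (real k + 1)"
      by (intro divide_right_mono B) auto
    also have "\<dots> = B * (1 / sqrt (real k + 1))" using sqrt_over_self[of "real k + 1"] by (simp flip: times_divide_eq_right)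
    also have "\<dots> \<le> B * (2 / sqrt (real k + 2))"
      by (intro mult_left_mono inverse_sqrt_Suc_le B)
    finally show ?thesis using Suc by (simp add: mult_ac add_ac)
  qed
  have a_diff: "\<bar>a (Suc n) - a n\<bar> \<le> 2 * (B + C) / ((real n + 1) * sqrt (real n + 1))" for n
  proof (cases n)
    case 0
    thus ?thesis using B(1)[of 0] B(2) C(2) by (simp add: a_def)
  next
    case (Suc k)
    have "a (Suc n) - a n = (E (Suc k) - E k) / (real k + 2) - E k / (real k + 1) / (real k + 2)"
    proof -
      have "a (Suc n) - a n = E (Suc k) / (real k + 2) - E k / (real k + 1)"
        using Suc by (simp add: a_def add_ac)
      moreover have "E k / (real k + 1) = E k / (real k + 2) + E k / (real k + 1) / (real k + 2)"
      proof -
        have "real k + 1 \<noteq> 0" "real k + 2 \<noteq> 0" by (auto simp: add_eq_0_iff)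
        thus ?thesis by (simp add: divide_simps) (simp add: algebra_simps)
      qed
      ultimately show ?thesis unfolding diff_divide_distrib by linarith
    qed
    hence "\<bar>a (Suc n) - a n\<bar> \<le> \<bar>E (Suc k) - E k\<bar> / (real k + 2) + \<bar>E k\<bar> / (real k + 1) / (real k + 2)"
      using abs_triangle_ineq4[of "(E (Suc k) - E k) / (real k + 2)" "E k / (real k + 1) / (real k + 2)"] by simp
    also have "\<dots> \<le> (C / sqrt (real k + 1)) / (real k + 2) + (B * sqrt (real k + 1)) / (real k + 1) / (real k + 2)"
      by (intro add_mono divide_right_mono B C) auto
    also have "\<dots> = (B + C) * (1 / sqrt (real k + 1)) / (real k + 2)"
    proof -
      have "(B * sqrt (real k + 1)) / (real k + 1) = B * (1 / sqrt (real k + 1))"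
        using sqrt_over_self[of "real k + 1"] by (simp flip: times_divide_eq_right)
      thus ?thesis by (simp add: add_divide_distrib distrib_right)
    qed
    also have "\<dots> \<le> (B + C) * (2 / sqrt (real k + 2)) / (real k + 2)"
      using B(2) C(2) by (intro divide_right_mono mult_left_mono inverse_sqrt_Suc_le) auto
    finally show ?thesis using Suc by (simp add: mult_ac add_ac)
  qed
  have "\<bar>D' (Suc n) - D' n\<bar> \<le> 2 * (B + C) / ((real n + 1) * sqrt (real n + 1))" for n
  proof -
    have "D' (Suc n) - D' n = (- 1) ^ Suc n * (a (Suc n) - a n) / 2"
    proof -
      have "D (Suc n) - D n = (- 1) ^ Suc n * a (Suc n)" using D(2)[of n] by (simp add: a_def)
      hence D_Suc: "D (Suc n) = D n + (- 1) ^ Suc n * a (Suc n)" by simp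
      show ?thesis unfolding D'_def D_Suc by (simp add: field_simps)
    qed
    hence "\<bar>D' (Suc n) - D' n\<bar> = \<bar>a (Suc n) - a n\<bar> / 2" by (simp add: abs_mult power_abs)
    also have "\<dots> \<le> \<bar>a (Suc n) - a n\<bar>" by simp
    finally show ?thesis using a_diff[of n] by linarith
  qed
  from harm_asymp_const_if_small_increments[OF this] obtain L K where
    L: "\<And>n. \<bar>D' n - L\<bar> \<le> K / sqrt (real n + 1)" unfolding harm_asymp_def by auto
  have "\<bar>D n - L\<bar> \<le> (K + 2 * B) / sqrt (real n + 1)" for n
  proof -
    have "\<bar>D n - L\<bar> \<le> \<bar>D' n - L\<bar> + \<bar>(- 1) ^ n * a n / 2\<bar>" unfolding D'_def by linarith
    also have "\<bar>(- 1) ^ n * a n / 2\<bar> \<le> \<bar>a n\<bar>" by (simp add: abs_mult power_abs)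
    finally show ?thesis using a_le[of n] L[of n] by (simp add: add_divide_distrib)
  qed
  thus ?thesis unfolding harm_asymp_def by auto
qed

text \<open>The case of a leading unbarred 1: summing P(H_n)/(n + 1) amounts to integrating P with
  respect to H_n. For an antiderivative R of P the difference from R(H_n) has increments of order
  n^(-3/2), and its limit supplies the constant of integration.\<close>

lemma harm_asymp_harmonic_weight:
  assumes E: "harm_asymp E P" and D: "\<And>n. D (Suc n) - D n = E n / real (Suc n)"
  shows "\<exists>P. harm_asymp D P"
proof -
  obtain C where C: "\<And>n. \<bar>E n - poly P (harm n)\<bar> \<le> C / sqrt (real n + 1)"
    using E unfolding harm_asymp_def by auto
  obtain R where R: "pderiv R = P" using ex_antiderivative_poly by blast
  obtain q where q: "\<And>h d. h \<ge> 0 \<Longrightarrow> d \<in> {0..1} \<Longrightarrow> \<bar>poly R (h + d) - poly R h - d * poly P h\<bar> \<le> d ^ 2 * poly q h"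
    using poly_taylor_bound[of R] R by blast
  obtain B where B: "B \<ge> 0" "\<And>n. \<bar>poly q (harm n)\<bar> \<le> B * sqrt (real n + 1)"
    using poly_harm_le_sqrt by blast
  define D' where "D' n = D n - poly R (harm n)" for n
  have "\<bar>D' (Suc n) - D' n\<bar> \<le> (C + B) / ((real n + 1) * sqrt (real n + 1))" for n
  proof -
    define d where "d = 1 / (real n + 1)"
    have d: "d \<in> {0..1}" by (auto simp: d_def)
    have h: "harm (Suc n) = harm n + d" by (simp add: harm_Suc d_def inverse_eq_divide add.commute)
    have "D' (Suc n) - D' n = d * (E n - poly P (harm n)) - (poly R (harm n + d) - poly R (harm n) - d * poly P (harm n))"
    proof -
      have "D (Suc n) - D n = d * E n" using D[of n] by (simp add: d_def add.commute)
      thus ?thesis unfolding D'_def h by (simp add: algebra_simps)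
    qed
    hence "\<bar>D' (Suc n) - D' n\<bar> \<le> d * \<bar>E n - poly P (harm n)\<bar> + \<bar>poly R (harm n + d) - poly R (harm n) - d * poly P (harm n)\<bar>"
      using abs_triangle_ineq4[of "d * (E n - poly P (harm n))"] d by (simp add: abs_mult)
    also have "\<dots> \<le> d * (C / sqrt (real n + 1)) + d ^ 2 * poly q (harm n)"
      using d C by (intro add_mono mult_left_mono q harm_nonneg) auto
    also have "\<dots> \<le> d * (C / sqrt (real n + 1)) + d ^ 2 * (B * sqrt (real n + 1))"
      using B(2)[of n] d by (intro add_mono mult_left_mono) auto
    also have "\<dots> = d * ((C + B) / sqrt (real n + 1))"
    proof -
      have "d * sqrt (real n + 1) = 1 / sqrt (real n + 1)"
        using sqrt_over_self[of "real n + 1"] by (simp add: d_def)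
      hence "d ^ 2 * (B * sqrt (real n + 1)) = d * (B * (1 / sqrt (real n + 1)))"
        by (simp add: power2_eq_square mult_ac)
      thus ?thesis by (simp add: add_divide_distrib distrib_left)
    qed
    finally show ?thesis by (simp add: d_def mult.commute)
  qed
  from harm_asymp_const_if_small_increments[OF this] obtain L K where
    "\<And>n. \<bar>D' n - L\<bar> \<le> K / sqrt (real n + 1)" unfolding harm_asymp_def by auto
  hence "harm_asymp D (R + [:L:])" unfolding harm_asymp_def D'_def by (auto simp: algebra_simps)
  thus ?thesis ..
qed

text \<open>The second conjunct is the convergent case. The third is carried along for the
  induction: a barred 1 in front is summed by parts, and this requires the increments of the sum
  over the remaining index to be small.\<close>

lemma harm_asymp_esum_trunc:
  assumes "\<forall>x\<in>set idx. 1 \<le> fst x"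
  shows "(\<exists>P. harm_asymp (esum_trunc idx) P) \<and>
     (\<forall>s b rest. idx = (s, b) # rest \<and> (s, b) \<noteq> (1, False) \<longrightarrow> (\<exists>L. harm_asymp (esum_trunc idx) [:L:])) \<and>
     (\<exists>C\<ge>0. \<forall>n. \<bar>esum_trunc idx (Suc n) - esum_trunc idx n\<bar> \<le> C / sqrt (real n + 1))"
  using assms
proof (induction idx)
  case Nil
  have "harm_asymp (esum_trunc []) 1" unfolding harm_asymp_def by (auto intro: exI[of _ 0])
  moreover have "\<exists>C\<ge>0. \<forall>n. \<bar>esum_trunc [] (Suc n) - esum_trunc [] n\<bar> \<le> C / sqrt (real n + 1)"
    by (auto intro: exI[of _ 0])
  ultimately show ?case by blast
next
  case (Cons x rest)
  obtain s b where x: "x = (s, b)" by (cases x)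
  define E where "E = esum_trunc rest"
  define D where "D = esum_trunc ((s, b) # rest)"
  have D: "D 0 = 0" "\<And>n. D (Suc n) - D n = zsgn b ^ Suc n / real (Suc n) ^ s * E n"
    by (auto simp: D_def E_def esum_trunc_Suc)
  have s: "s \<ge> 1" using Cons.prems x by auto
  note IH = Cons.IH[folded E_def]
  obtain P where P: "harm_asymp E P" using IH Cons.prems by auto
  obtain C where C: "C \<ge> 0" "\<And>n. \<bar>E (Suc n) - E n\<bar> \<le> C / sqrt (real n + 1)" using IH Cons.prems by auto
  obtain B where B: "B \<ge> 0" "\<And>n. \<bar>E n\<bar> \<le> B * sqrt (real n + 1)" using harm_asymp_le_sqrt[OF P] by auto
  \<comment> \<open>The free exponent k serves two purposes: k = 1 yields the bound that the
    induction has to hand on, and k = 2 yields summable increments when s \<ge> 2.\<close>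
  have D_le: "\<bar>D (Suc n) - D n\<bar> \<le> B / (sqrt (real n + 1) * (real n + 1) ^ (k - 1))" if "k \<le> s" "k \<ge> 1" for n k
  proof -
    have "\<bar>D (Suc n) - D n\<bar> = \<bar>E n\<bar> / (real n + 1) ^ s"
      by (simp add: D abs_mult add_ac del: power_Suc)
    also have "\<dots> \<le> (B * sqrt (real n + 1)) / (real n + 1) ^ k"
      using that B by (intro frac_le B power_increasing) auto
    also have "(real n + 1) ^ k = (real n + 1) ^ (k - 1) * (real n + 1)"
      using that by (cases k) auto
    also have "(B * sqrt (real n + 1)) / \<dots> = B * (sqrt (real n + 1) / (real n + 1)) / (real n + 1) ^ (k - 1)"
      by simp
    also have "\<dots> = B / (sqrt (real n + 1) * (real n + 1) ^ (k - 1))"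
      by (subst sqrt_over_self) auto
    finally show ?thesis .
  qed
  have *: "\<exists>L. harm_asymp D [:L:]" if "(s, b) \<noteq> (1, False)"
  proof (cases "s = 1")
    case True
    with that have "b" by auto
    show ?thesis
      using B C D True \<open>b\<close> by (intro harm_asymp_alternating[where E = E and B = B and C = C and D = D]) auto
  next
    case False
    show ?thesis
      by (rule harm_asymp_const_if_small_increments[of D B])
         (use D_le[of 2] False s in \<open>simp add: mult.commute\<close>)
  qed
  have "\<exists>P. harm_asymp D P"
  proof (cases "(s, b) = (1, False)")
    case True
    show ?thesis by (rule harm_asymp_harmonic_weight[OF P]) (use D True in auto)
  qed (use * in blast)
  moreover have "\<exists>C\<ge>0. \<forall>n. \<bar>D (Suc n) - D n\<bar> \<le> C / sqrt (real n + 1)"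
    using B(1) D_le[of 1] s by auto
  ultimately show ?case using * unfolding x D_def by blast
qed

section \<open>From harmonic numbers to ln M + gamma\<close>

abbreviation ln_gamma :: "nat \<Rightarrow> real" where
  "ln_gamma M \<equiv> ln (real M) + euler_mascheroni"

lemma harm_asymp_imp_asymp_poly:
  assumes "harm_asymp E P"
  shows "asymp_poly sequentially ln_gamma E P"
proof -
  \<comment> \<open>Up to the factor exp(-gamma/2), the quantity
    \<open>exp (- ln_gamma n / 2)\<close> is n^(-1/2); the constant compensates for that
    factor.\<close>
  have inv: "1 / sqrt (real n + 1) \<le> exp (euler_mascheroni / 2) * exp (- ln_gamma n / 2)" if "n \<ge> 1" for n
  proof -
    have "exp (euler_mascheroni / 2) * exp (- ln_gamma n / 2) = exp (- (ln (real n) / 2))"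
      by (simp add: flip: exp_add) (simp add: field_simps)
    also have "\<dots> = 1 / sqrt (real n)"
      using that by (simp add: exp_minus ln_sqrt[symmetric] inverse_eq_divide)
    finally have *: "exp (euler_mascheroni / 2) * exp (- ln_gamma n / 2) = 1 / sqrt (real n)" .
    show ?thesis unfolding * using that by (intro frac_le) auto
  qed
  have "asymp_poly sequentially ln_gamma harm [:0, 1:]"
  proof (rule asymp_polyI_exp[OF filterlim_ln_plus_euler_mascheroni])
    show "\<forall>\<^sub>F n in sequentially. \<bar>harm n - poly [:0, 1:] (ln_gamma n)\<bar> \<le> 2 * exp (euler_mascheroni / 2) * exp (- ln_gamma n / 2)"
      using eventually_ge_at_top[of 1]
    proof eventually_elim
      case (elim n)
      have "ln (real (Suc n)) - ln (real n) \<le> 1 / real n"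
        using elim ln_diff_le_inverse[of "real n"] by (simp add: inverse_eq_divide add.commute)
      moreover have "ln (real n) \<le> ln (real (Suc n))" using elim by simp
      moreover have "inverse (of_nat (2*n)) \<le> 1 / real n" "inverse (of_nat (2*(n+1))) \<ge> (0::real)"
        using elim by (auto simp: field_simps)
      moreover have "harm n - ln (real (Suc n)) + inverse (of_nat (2*(n+1))) \<le> euler_mascheroni"
          "euler_mascheroni \<le> harm n - ln (real (Suc n)) + inverse (of_nat (2*n))"
        using euler_mascheroni_bounds[OF elim] by auto
      ultimately have "\<bar>harm n - ln_gamma n\<bar> \<le> 1 / real n"
        by (intro abs_leI) linarith+
      also have "\<dots> \<le> 2 / (real n + 1)" using elim by (simp add: field_simps)
      also have "\<dots> \<le> 2 / sqrt (real n + 1)"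
      proof (intro divide_left_mono)
        have "sqrt (real n + 1) \<le> sqrt ((real n + 1) * (real n + 1))"
          by (intro real_sqrt_le_mono) (simp add: mult_le_cancel_left1)
        thus "sqrt (real n + 1) \<le> real n + 1" by simp
      qed auto
      finally show ?case using inv[OF elim] by simp
    qed
  qed
  hence P: "asymp_poly sequentially ln_gamma (\<lambda>n. poly P (harm n)) P" by (rule asymp_poly_poly)
  obtain C where C: "\<And>n. \<bar>E n - poly P (harm n)\<bar> \<le> C / sqrt (real n + 1)"
    using assms unfolding harm_asymp_def by blast
  have "0 \<le> \<bar>E 0 - poly P (harm 0)\<bar>" by simp
  also have "\<dots> \<le> C" using C[of 0] by simp
  finally have "C \<ge> 0" .
  have "asymp_poly sequentially ln_gamma (\<lambda>n. E n - poly P (harm n)) 0"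
  proof (rule asymp_polyI_exp[OF filterlim_ln_plus_euler_mascheroni])
    show "\<forall>\<^sub>F n in sequentially. \<bar>E n - poly P (harm n) - poly 0 (ln_gamma n)\<bar> \<le> (C * exp (euler_mascheroni / 2)) * exp (- ln_gamma n / 2)"
      using eventually_ge_at_top[of 1]
    proof eventually_elim
      case (elim n)
      have "C / sqrt (real n + 1) \<le> C * (exp (euler_mascheroni / 2) * exp (- ln_gamma n / 2))"
        using mult_left_mono[OF inv[OF elim] \<open>C \<ge> 0\<close>] by simp
      thus ?case using C[of n] by simp
    qed
  qed
  from asymp_poly_add[OF this P] show ?thesis by simp
qed

lemma asymp_poly_esum_trunc:
  assumes "\<forall>x\<in>set idx. 1 \<le> fst x"
  shows "asymp_poly sequentially ln_gamma (esum_trunc idx) (zeta_st idx)"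
proof -
  obtain P where "harm_asymp (esum_trunc idx) P"
    using harm_asymp_esum_trunc[of idx] assms by blast
  hence P: "asymp_poly sequentially ln_gamma (esum_trunc idx) P" by (rule harm_asymp_imp_asymp_poly)
  with zeta_st_eqI[OF asymp_polyD[OF P]] show ?thesis by simp
qed

lemma esum_trunc_convergent:
  assumes "\<forall>x\<in>set ((s, b) # rest). 1 \<le> fst x" and "(s, b) \<noteq> (1, False)"
  shows "esum_trunc ((s, b) # rest) \<longlonglongrightarrow> euler_zeta ((s, b) # rest)"
    and "zeta_st ((s, b) # rest) = zc ((s, b) # rest)"
proof -
  let ?i = "(s, b) # rest"
  obtain L where "harm_asymp (esum_trunc ?i) [:L:]"
    using harm_asymp_esum_trunc[of ?i] assms by blast
  hence P: "(\<lambda>M. esum_trunc ?i M - poly [:L:] (ln_gamma M)) \<longlonglongrightarrow> 0"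
    by (intro asymp_polyD harm_asymp_imp_asymp_poly)
  hence L: "esum_trunc ?i \<longlonglongrightarrow> L" by (simp add: LIM_zero_iff)
  hence "euler_zeta ?i = L" unfolding euler_zeta_def by (rule limI)
  with L show "esum_trunc ?i \<longlonglongrightarrow> euler_zeta ?i" by simp
  show "zeta_st ?i = zc ?i" using zeta_st_eqI[OF P] \<open>euler_zeta ?i = L\<close> by (simp add: zc_def)
qed

lemma zeta_st_1: "zeta_st [(1, False)] = [:0, 1:]"
proof -
  have "harm_asymp (esum_trunc [(1, False)]) [:0, 1:]"
    unfolding harm_asymp_def
    by (auto intro!: exI[of _ 0] simp: harm_def esum_trunc.simps(2) inverse_eq_divide)
  thus ?thesis by (intro zeta_st_eqI asymp_polyD harm_asymp_imp_asymp_poly)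
qed

section \<open>Iterated integrals as power series\<close>

text \<open>Coefficients of the power series of the iterated integral over a word; for nonempty words the
  coefficient at \<open>n = 0\<close> is 0 because of the division by \<open>n\<close>.\<close>

primrec word_coeff :: "real list \<Rightarrow> nat \<Rightarrow> real" where
  "word_coeff [] n = (if n = 0 then 1 else 0)"
| "word_coeff (a # as) n =
     (if a = 0 then word_coeff as n / real n else a ^ n / real n * (\<Sum>m<n. a ^ m * word_coeff as m))"

text \<open>Apart from the restriction to letters 0, 1 and -1, this excludes words ending in the
  letter 0, whose innermost integral of dt/t diverges at 0. A leading letter 1 is allowed: it
  affects only the behaviour at 1, which the regularization handles.\<close>

primrec admissible :: "real list \<Rightarrow> bool" where
  "admissible [] = True"
| "admissible (a # as) \<longleftrightarrow> admissible as \<and> (a = 1 \<or> a = -1 \<or> a = 0 \<and> as \<noteq> [])"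

text \<open>A letter 1 or -1 adds up n numbers of modulus at most 1 and divides by n. The crude
  bound suffices for convergence on the open unit interval.\<close>

lemma word_coeff_le_1: "admissible as \<Longrightarrow> \<bar>word_coeff as n\<bar> \<le> 1"
proof (induction as arbitrary: n)
  case (Cons a as)
  show ?case
  proof (cases "n = 0")
    case False
    show ?thesis
    proof (cases "a = 0")
      case True
      have "\<bar>word_coeff as n\<bar> / real n \<le> 1 / 1"
        using Cons False by (intro frac_le) auto
      thus ?thesis using True by simp
    next
      case a: False
      hence a1: "\<bar>a\<bar> = 1" using Cons.prems by auto
      have "\<bar>\<Sum>m<n. a ^ m * word_coeff as m\<bar> \<le> (\<Sum>m<n. 1)"
        by (rule order.trans[OF sum_abs], rule sum_mono)
           (use Cons a1 in \<open>auto simp: abs_mult power_abs\<close>)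
      hence "\<bar>\<Sum>m<n. a ^ m * word_coeff as m\<bar> \<le> real n" by simp
      thus ?thesis using a a1 False by (simp add: abs_mult power_abs divide_simps)
    qed
  qed simp
qed auto

definition word_series :: "real list \<Rightarrow> real \<Rightarrow> real" where
  "word_series as x = (\<Sum>n. word_coeff as n * x ^ n)"

lemma summable_word_series:
  assumes "admissible as" "\<bar>x\<bar> < 1"
  shows "summable (\<lambda>n. word_coeff as n * x ^ n)"
proof (rule summable_comparison_test')
  show "summable (\<lambda>n. \<bar>x\<bar> ^ n)" using assms by (intro summable_geometric) auto
  show "norm (word_coeff as n * x ^ n) \<le> \<bar>x\<bar> ^ n" for n
    using mult_right_mono[OF word_coeff_le_1[OF assms(1), of n], of "\<bar>x\<bar> ^ n"]
    by (simp add: abs_mult power_abs)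
qed

lemma word_series_0 [simp]: "word_series as 0 = word_coeff as 0"
  unfolding word_series_def by (rule powser_zero)

lemma word_series_Nil [simp]: "word_series [] x = 1"
proof -
  have "(\<lambda>n. word_coeff [] n * x ^ n) sums (\<Sum>n\<in>{0}. word_coeff [] n * x ^ n)"
    by (rule sums_finite) auto
  thus ?thesis unfolding word_series_def by (simp add: sums_unique[symmetric])
qed

text \<open>For a letter a with a^2 = 1, the form 1/(a - x) is the series of a^(n + 1) x^n, and the
  coefficients of \<open>word_coeff\<close> are the integrated Cauchy product with it. At x = 0 the
  letter 0 has a pole, hence the hypothesis \<open>nz\<close>.\<close>

lemma word_series_Cons_deriv:
  assumes adm: "admissible (a # as)" and x: "\<bar>x\<bar> < 1" and nz: "x \<noteq> 0 \<or> a \<noteq> 0"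
  shows "(word_series (a # as) has_real_derivative form a x * word_series as x) (at x)"
proof -
  have adm': "admissible as" using adm by simp
  let ?c = "word_coeff (a # as)"
  have "((\<lambda>z. \<Sum>n. ?c n * z ^ n) has_field_derivative (\<Sum>n. diffs ?c n * x ^ n)) (at x)"
    by (rule termdiffs_strong'[of 1]) (use x summable_word_series[OF adm] in \<open>simp_all del: word_coeff.simps\<close>)
  moreover have sm: "summable (\<lambda>n. diffs ?c n * x ^ n)"
    by (rule termdiff_converges[of x 1]) (use x summable_word_series[OF adm] in \<open>simp_all del: word_coeff.simps\<close>)
  moreover have "(\<Sum>n. diffs ?c n * x ^ n) = form a x * word_series as x"
  proof (cases "a = 0")
    case True
    hence x0: "x \<noteq> 0" and "as \<noteq> []" using nz adm by auto
    hence c0: "word_coeff as 0 = 0" by (cases as) auto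
    have "diffs ?c n = word_coeff as (Suc n)" for n using True by (simp add: diffs_def)
    hence "x * (\<Sum>n. diffs ?c n * x ^ n) = (\<Sum>n. word_coeff as (Suc n) * x ^ Suc n)"
      using suminf_mult[OF sm, of x] by (simp add: mult_ac)
    also have "\<dots> = word_series as x"
      unfolding word_series_def using suminf_split_head[OF summable_word_series[OF adm' x]] c0 by simp
    finally show ?thesis using True x0 by (simp add: form_def field_simps)
  next
    case False
    hence aa: "a * a = 1" using adm by auto
    \<comment> \<open>Instead of multiplying series, the derivative is multiplied by a - x: the
      recurrence a e(n + 1) - e(n) = \<open>word_coeff as (Suc n)\<close> turns the product back
      into the series of the shorter word.\<close>
    define e where "e n = a ^ Suc n * (\<Sum>m<Suc n. a ^ m * word_coeff as m)" for n
    have d: "diffs ?c n = e n" for n using False by (simp add: diffs_def e_def)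
    define S where "S = (\<Sum>n. e n * x ^ n)"
    have S: "(\<lambda>n. e n * x ^ n) sums S" using sm unfolding d S_def by (rule summable_sums)
    have pow: "a ^ n * a ^ n = 1" for n by (metis aa power_mult_distrib power_one)
    have e_Suc: "a * e (Suc n) - e n = word_coeff as (Suc n)" for n
    proof -
      have "a * e (Suc n) = (a * a) * a ^ Suc n * (\<Sum>m<Suc (Suc n). a ^ m * word_coeff as m)"
        by (simp add: e_def)
      also have "\<dots> = e n + (a ^ Suc n * a ^ Suc n) * word_coeff as (Suc n)"
        unfolding aa by (simp add: e_def algebra_simps)
      finally show ?thesis using pow[of "Suc n"] by simp
    qed
    have "(\<lambda>n. a * (e n * x ^ n)) sums (a * S)" by (rule sums_mult[OF S])
    hence "(\<lambda>n. a * (e (Suc n) * x ^ Suc n)) sums (a * S - a * (e 0 * x ^ 0))"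
      by (subst sums_Suc_iff) simp
    hence "(\<lambda>n. a * (e (Suc n) * x ^ Suc n) - x * (e n * x ^ n)) sums (a * S - a * (e 0 * x ^ 0) - x * S)"
      by (intro sums_diff sums_mult S)
    moreover have "a * (e (Suc n) * x ^ Suc n) - x * (e n * x ^ n) = word_coeff as (Suc n) * x ^ Suc n" for n
      unfolding e_Suc[symmetric] by (simp add: algebra_simps)
    moreover have "a * (e 0 * x ^ 0) = word_coeff as 0 * x ^ 0" by (simp add: e_def aa flip: mult.assoc)
    ultimately have "(\<lambda>n. word_coeff as (Suc n) * x ^ Suc n) sums (a * S - word_coeff as 0 * x ^ 0 - x * S)"
      by simp
    hence "(\<lambda>n. word_coeff as n * x ^ n) sums (a * S - x * S)"
      unfolding sums_Suc_iff[of "\<lambda>n. word_coeff as n * x ^ n"] by (simp add: algebra_simps)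
    hence "word_series as x = (a - x) * S"
      unfolding word_series_def by (simp add: sums_unique[symmetric] algebra_simps)
    moreover have "a - x \<noteq> 0" using adm x False by auto
    ultimately show ?thesis using False by (simp add: form_def S_def d)
  qed
  ultimately show ?thesis unfolding word_series_def[abs_def] by simp
qed

lemma isCont_word_series:
  assumes "admissible as" "\<bar>x\<bar> < 1"
  shows "isCont (word_series as) x"
proof -
  have "((\<lambda>z. \<Sum>n. word_coeff as n * z ^ n) has_field_derivative (\<Sum>n. diffs (word_coeff as) n * x ^ n)) (at x)"
    by (rule termdiffs_strong'[of 1]) (use assms summable_word_series in auto)
  thus ?thesis unfolding word_series_def[abs_def] by (rule DERIV_isCont)
qed

lemma iter_int_eq_word_series:
  assumes "admissible as" "0 \<le> x" "x < 1"
  shows "iter_int as x = word_series as x"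
  using assms
proof (induction as arbitrary: x)
  case (Cons a as)
  have "((\<lambda>t. form a t * iter_int as t) has_integral (word_series (a # as) x - word_series (a # as) 0)) {0..x}"
  \<comment> \<open>The derivative formula may fail at 0, where the letter 0 has its pole; in the
    interior version continuity at the end points is enough.\<close>
  proof (rule fundamental_theorem_of_calculus_interior)
    show "continuous_on {0..x} (word_series (a # as))"
      using Cons.prems by (intro continuous_at_imp_continuous_on ballI isCont_word_series) auto
    fix t assume t: "t \<in> {0<..<x}"
    hence "iter_int as t = word_series as t" using Cons by auto
    with t Cons.prems word_series_Cons_deriv[of a as t]
    show "(word_series (a # as) has_vector_derivative form a t * iter_int as t) (at t)"
      by (simp add: has_real_derivative_iff_has_vector_derivative)
  qed (use Cons.prems in auto)
  thus ?case by (simp add: integral_unique)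
qed simp

section \<open>Behaviour of iterated integrals near 1\<close>

lemma exp_decay_derivative_imp_limit:
  fixes D :: "real \<Rightarrow> real"
  assumes deriv: "\<And>y. y \<ge> 1 \<Longrightarrow> (D has_real_derivative d y) (at y)"
    and bnd: "\<And>y. y \<ge> 1 \<Longrightarrow> \<bar>d y\<bar> \<le> C * exp (- y / 2)"
  shows "\<exists>L. \<forall>y\<ge>1. \<bar>D y - L\<bar> \<le> 2 * C * exp (- y / 2)"
proof (rule eventually_close_to_constant)
  \<comment> \<open>The derivative of \<open>\<phi>\<close> is minus the bound on the derivative of
    \<open>D\<close>; therefore D + \<phi> decreases and D - \<phi> increases, which is the nesting
    required by \<open>eventually_close_to_constant\<close>.\<close>
  define \<phi> where "\<phi> y = 2 * C * exp (- y / 2)" for y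
  have \<phi>: "(\<phi> has_real_derivative - (C * exp (- y / 2))) (at y)" for y
    unfolding \<phi>_def by (auto intro!: derivative_eq_intros)
  have "0 \<le> \<bar>d 1\<bar>" by simp
  also have "\<dots> \<le> C * exp (- 1 / 2)" by (rule bnd) simp
  finally have "C \<ge> 0" by (simp add: zero_le_mult_iff)
  thus "0 \<le> 2 * C * exp (- x / 2)" for x by simp
  fix x y :: real assume xy: "1 \<le> x" "x \<le> y"
  have "D x + \<phi> x \<ge> D y + \<phi> y"
  proof (rule DERIV_nonpos_imp_nonincreasing[OF xy(2)])
    fix t assume "x \<le> t" "t \<le> y"
    thus "\<exists>z. ((\<lambda>t. D t + \<phi> t) has_real_derivative z) (at t) \<and> z \<le> 0"
      using deriv[of t] \<phi>[of t] bnd[of t] xy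
      by (intro exI[of _ "d t + - (C * exp (- t / 2))"] conjI DERIV_add) auto
  qed
  moreover have "D x - \<phi> x \<le> D y - \<phi> y"
  proof (rule DERIV_nonneg_imp_nondecreasing[OF xy(2)])
    fix t assume "x \<le> t" "t \<le> y"
    thus "\<exists>z. ((\<lambda>t. D t - \<phi> t) has_real_derivative z) (at t) \<and> z \<ge> 0"
      using deriv[of t] \<phi>[of t] bnd[of t] xy
      by (intro exI[of _ "d t - - (C * exp (- t / 2))"] conjI DERIV_diff) auto
  qed
  ultimately show "\<bar>D y - D x\<bar> \<le> 2 * C * exp (- x / 2) - 2 * C * exp (- y / 2)"
    unfolding \<phi>_def by linarith
qed

text \<open>In the variable y = -ln(1 - x) the form dx/(1 - x) becomes dy, so the letter 1
  integrates a polynomial in y to a polynomial in y. For the other letters the form stays bounded on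
  x \<ge> 1/2, and dx = exp(-y) dy makes the integral converge to a constant. The restriction y
  \<ge> 1 guarantees x \<ge> 1/2.\<close>

lemma word_series_asymptotics:
  assumes "admissible as"
  shows "\<exists>Q C. \<forall>y\<ge>1. \<bar>word_series as (1 - exp (- y)) - poly Q y\<bar> \<le> C * exp (- y / 2)"
  using assms
proof (induction as)
  case Nil
  show ?case by (intro exI[of _ 1] exI[of _ 0]) simp
next
  case (Cons a as)
  from Cons obtain Q C where QC: "\<And>y. y \<ge> 1 \<Longrightarrow> \<bar>word_series as (1 - exp (- y)) - poly Q y\<bar> \<le> C * exp (- y / 2)"
    by auto
  define X :: "real \<Rightarrow> real" where "X y = 1 - exp (- y)" for y
  define F where "F y = word_series (a # as) (X y)" for y
  define f where "f y = word_series as (X y)" for y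
  have X: "0 < X y" "X y < 1" if "y \<ge> 1" for y using that by (auto simp: X_def)
  have X2: "X y \<ge> 1 / 2" if "y \<ge> 1" for y
  proof -
    have "2 \<le> exp y" using exp_ge_add_one_self[of y] that by linarith
    hence "exp (- y) \<le> 1 / 2" by (simp add: exp_minus field_simps)
    thus ?thesis by (simp add: X_def)
  qed
  have F: "(F has_real_derivative form a (X y) * f y * exp (- y)) (at y)" if "y \<ge> 1" for y
    unfolding F_def f_def
    by (rule DERIV_chain2[where g = X])
       (use X[OF that] Cons.prems in \<open>auto intro!: word_series_Cons_deriv derivative_eq_intros simp: X_def[abs_def]\<close>)
  show ?case
  proof (cases "a = 1")
    case True
    obtain R where R: "pderiv R = Q" using ex_antiderivative_poly by blast
    have "\<exists>L. \<forall>y\<ge>1. \<bar>(F y - poly R y) - L\<bar> \<le> 2 * C * exp (- y / 2)"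
    proof (rule exp_decay_derivative_imp_limit)
      fix y :: real assume y: "y \<ge> 1"
      have "form a (X y) * f y * exp (- y) = f y" using True by (simp add: form_def X_def)
      with F[OF y] have "(F has_real_derivative f y) (at y)" by simp
      thus "((\<lambda>y. F y - poly R y) has_real_derivative f y - poly Q y) (at y)"
        using poly_DERIV[of R y] by (intro DERIV_diff) (auto simp: R)
      show "\<bar>f y - poly Q y\<bar> \<le> C * exp (- y / 2)" using QC[OF y] by (simp add: f_def X_def)
    qed
    then obtain L where "\<And>y. y \<ge> 1 \<Longrightarrow> \<bar>(F y - poly R y) - L\<bar> \<le> 2 * C * exp (- y / 2)" by blast
    hence "\<forall>y\<ge>1. \<bar>word_series (a # as) (1 - exp (- y)) - poly (R + [:L:]) y\<bar> \<le> 2 * C * exp (- y / 2)"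
      by (auto simp: F_def X_def algebra_simps)
    thus ?thesis by blast
  next
    case False
    obtain B where B: "B \<ge> 0" "\<And>y. y \<ge> 0 \<Longrightarrow> \<bar>poly Q y\<bar> \<le> B * exp (1 / 2 * y)"
      using poly_bounded_by_exp[of "1/2" Q] by auto
    \<comment> \<open>The growth exp(y/2) is deliberately generous: against the factor exp(-y) of dx
      it leaves exactly the decay exp(-y/2) of the claim.\<close>
    have f_le: "\<bar>f y\<bar> \<le> (B + \<bar>C\<bar>) * exp (y / 2)" if y: "y \<ge> 1" for y
    proof -
      have "C * exp (- y / 2) \<le> \<bar>C\<bar> * exp (y / 2)" using y by (intro mult_mono) auto
      thus ?thesis using QC[OF y] B(2)[of y] y by (simp add: f_def X_def algebra_simps)
    qed
    have "\<exists>L. \<forall>y\<ge>1. \<bar>F y - L\<bar> \<le> 2 * (2 * (B + \<bar>C\<bar>)) * exp (- y / 2)"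
    proof (rule exp_decay_derivative_imp_limit)
      fix y :: real assume y: "y \<ge> 1"
      show "(F has_real_derivative form a (X y) * f y * exp (- y)) (at y)" by (rule F[OF y])
      have "\<bar>form a (X y)\<bar> \<le> 2"
      proof (cases "a = 0")
        case True
        thus ?thesis using X2[OF y] by (simp add: form_def field_simps)
      next
        case a: False
        hence "a = -1" using False Cons.prems by auto
        thus ?thesis using X2[OF y] by (simp add: form_def abs_divide field_simps)
      qed
      hence "\<bar>form a (X y) * f y * exp (- y)\<bar> \<le> 2 * ((B + \<bar>C\<bar>) * exp (y / 2)) * exp (- y)"
        unfolding abs_mult using f_le[OF y] B(1) by (intro mult_mono) auto
      also have "\<dots> = 2 * (B + \<bar>C\<bar>) * (exp (y / 2) * exp (- y))" by (simp only: mult_ac)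
      also have "exp (y / 2) * exp (- y) = exp (- y / 2)" by (simp flip: exp_add)
      finally show "\<bar>form a (X y) * f y * exp (- y)\<bar> \<le> 2 * (B + \<bar>C\<bar>) * exp (- y / 2)" .
    qed
    then obtain L where "\<And>y. y \<ge> 1 \<Longrightarrow> \<bar>F y - L\<bar> \<le> 2 * (2 * (B + \<bar>C\<bar>)) * exp (- y / 2)" by blast
    hence "\<forall>y\<ge>1. \<bar>word_series (a # as) (1 - exp (- y)) - poly [:L:] y\<bar> \<le> 2 * (2 * (B + \<bar>C\<bar>)) * exp (- y / 2)"
      by (auto simp: F_def X_def)
    thus ?thesis by blast
  qed
qed

section \<open>Words of Euler sums and the convergent case\<close>

lemma admissible_replicate: "as \<noteq> [] \<Longrightarrow> admissible as \<Longrightarrow> admissible (replicate k 0 @ as)"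
  by (induction k) auto

lemma zsgn_cases: "zsgn b = 1 \<or> zsgn b = -1"
  by (cases b) auto

lemma admissible_word_aux: "a = 1 \<or> a = -1 \<Longrightarrow> admissible (word_aux a idx)"
proof (induction a idx rule: word_aux.induct)
  case (2 a s b rest)
  have "a * zsgn b = 1 \<or> a * zsgn b = -1" using 2 zsgn_cases[of b] by auto
  thus ?case using 2 by (auto intro!: admissible_replicate)
qed simp

lemma admissible_word: "admissible (word idx)"
  by (simp add: word_def admissible_word_aux)

lemma word_coeff_replicate_0: "word_coeff (replicate k 0 @ as) n = word_coeff as n / real n ^ k"
  by (induction k) auto

text \<open>The letters of a word are the cumulative products of the signs, whereas
  \<open>esum_trunc\<close> uses the signs themselves. The twist by a^m undoes the accumulation: for
  consecutive letters a and c the product ac is the sign between them, since a^2 = 1.\<close>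

lemma sum_word_coeff_word_aux:
  assumes "\<forall>x\<in>set idx. 1 \<le> fst x" "a = 1 \<or> a = -1"
  shows "(\<Sum>m<Suc n. a ^ m * word_coeff (word_aux a idx) m) = esum_trunc idx n"
  using assms
proof (induction a idx arbitrary: n rule: word_aux.induct)
  case (1 a)
  show ?case by (induction n) auto
next
  case (2 a s b rest)
  define c where "c = a * zsgn b"
  have c: "c = 1 \<or> c = -1" using 2 zsgn_cases[of b] by (auto simp: c_def)
  have IH: "(\<Sum>m<Suc n. c ^ m * word_coeff (word_aux c rest) m) = esum_trunc rest n" for n
    using 2 c by (simp add: c_def)
  have ac: "a ^ n * c ^ n = zsgn b ^ n" for n
  proof -
    have "a * c = zsgn b" using 2(3) by (auto simp: c_def)
    thus ?thesis by (metis power_mult_distrib)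
  qed
  have s: "s \<ge> 1" using 2 by simp
  have coeff: "a ^ Suc n * word_coeff (word_aux a ((s, b) # rest)) (Suc n) =
      zsgn b ^ Suc n / real (Suc n) ^ s * esum_trunc rest n" for n
  proof -
    have "word_coeff (word_aux a ((s, b) # rest)) (Suc n) =
        c ^ Suc n / real (Suc n) * esum_trunc rest n / real (Suc n) ^ (s - 1)"
      using c IH[of n] by (auto simp: word_coeff_replicate_0 c_def simp del: power_Suc)
    also have "\<dots> = c ^ Suc n / real (Suc n) ^ s * esum_trunc rest n"
      using s by (cases s) (auto simp del: of_nat_Suc simp: mult.commute)
    finally show ?thesis using ac[of "Suc n"] by (simp del: of_nat_Suc power_Suc word_aux.simps flip: mult.assoc)
  qed
  show ?case
  proof (induction n)
    case 0
    have "word_coeff (word_aux a ((s, b) # rest)) 0 = 0"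
      by (cases "s - 1") (auto simp: word_coeff_replicate_0)
    thus ?case by simp
  next
    case (Suc n)
    show ?case
      unfolding esum_trunc_Suc sum.lessThan_Suc[of _ "Suc n"] coeff Suc by simp
  qed
qed

lemma sum_word_coeff_word:
  "\<forall>x\<in>set idx. 1 \<le> fst x \<Longrightarrow> (\<Sum>m<Suc n. word_coeff (word idx) m) = esum_trunc idx n"
  using sum_word_coeff_word_aux[of idx 1 n] by (simp add: word_def)

lemma asymp_poly_word_series:
  "asymp_poly (at_right 0) (\<lambda>\<epsilon>. - ln \<epsilon>) (\<lambda>\<epsilon>. word_series (word idx) (1 - \<epsilon>)) (zeta_sh idx)"
proof -
  obtain Q C where QC: "\<And>y. y \<ge> 1 \<Longrightarrow> \<bar>word_series (word idx) (1 - exp (- y)) - poly Q y\<bar> \<le> C * exp (- y / 2)"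
    using word_series_asymptotics[OF admissible_word] by blast
  have ev: "eventually (\<lambda>\<epsilon>::real. 0 < \<epsilon> \<and> \<epsilon> < 1) (at_right 0)"
    using eventually_at_right_real[of 0 "1::real"] by simp
  have "eventually (\<lambda>\<epsilon>::real. - ln \<epsilon> \<ge> 1) (at_right 0)"
    using filterlim_minus_ln_at_right_0 unfolding filterlim_at_top by blast
  with ev have "eventually (\<lambda>\<epsilon>. \<bar>word_series (word idx) (1 - \<epsilon>) - poly Q (- ln \<epsilon>)\<bar> \<le> C * exp (- (- ln \<epsilon>) / 2)) (at_right 0)"
  proof eventually_elim
    case (elim \<epsilon>)
    thus ?case using QC[of "- ln \<epsilon>"] by simp
  qed
  from asymp_polyI_exp[OF filterlim_minus_ln_at_right_0 this]
  have Q: "asymp_poly (at_right 0) (\<lambda>\<epsilon>. - ln \<epsilon>) (\<lambda>\<epsilon>. word_series (word idx) (1 - \<epsilon>)) Q" .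
  have "eventually (\<lambda>\<epsilon>. word_series (word idx) (1 - \<epsilon>) = iter_int (word idx) (1 - \<epsilon>)) (at_right 0)"
    using ev by eventually_elim (auto simp: iter_int_eq_word_series admissible_word)
  from zeta_sh_eqI[OF asymp_polyD[OF asymp_poly_cong[OF Q this]]] Q show ?thesis by simp
qed

text \<open>Abel's theorem, by summation by parts: with t_n the n-th partial sum minus L, the power
  series minus L is (1 - x) times the series of t_n x^n.\<close>

lemma abel_limit:
  fixes c :: "nat \<Rightarrow> real"
  assumes c: "c sums L"
  shows "((\<lambda>x. \<Sum>n. c n * x ^ n) \<longlongrightarrow> L) (at_left 1)"
proof -
  define t where "t n = (\<Sum>m<Suc n. c m) - L" for n
  have t0: "t \<longlonglongrightarrow> 0"
    using LIMSEQ_Suc[OF c[unfolded sums_def]] unfolding t_def by (simp add: LIM_zero_iff del: sum.lessThan_Suc)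
  obtain B where B: "B > 0" "\<And>n. \<bar>t n\<bar> \<le> B"
    using convergent_imp_Bseq[of t] t0 unfolding convergent_def Bseq_def by auto
  have key: "(\<Sum>n. c n * x ^ n) - L = (1 - x) * (\<Sum>n. t n * x ^ n) \<and> summable (\<lambda>n. \<bar>t n\<bar> * x ^ n)"
    if x: "0 \<le> x" "x < 1" for x
  proof -
    have sm: "summable (\<lambda>n. \<bar>t n\<bar> * x ^ n)"
      by (rule summable_comparison_test'[of "\<lambda>n. B * x ^ n"])
         (use x B in \<open>auto intro!: summable_mult summable_geometric mult_right_mono simp: abs_mult power_abs\<close>)
    have "summable (\<lambda>n. t n * x ^ n)"
      by (rule summable_norm_cancel) (use sm x in \<open>simp add: abs_mult power_abs\<close>)
    hence S: "(\<lambda>n. t n * x ^ n) sums (\<Sum>n. t n * x ^ n)" (is "_ sums ?S") by (rule summable_sums)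
    hence "(\<lambda>n. t (Suc n) * x ^ Suc n) sums (?S - t 0 * x ^ 0)" by (subst sums_Suc_iff) simp
    hence "(\<lambda>n. t (Suc n) * x ^ Suc n - x * (t n * x ^ n)) sums (?S - t 0 * x ^ 0 - x * ?S)"
      by (intro sums_diff sums_mult S)
    moreover have "t (Suc n) * x ^ Suc n - x * (t n * x ^ n) = c (Suc n) * x ^ Suc n" for n
      by (simp add: t_def algebra_simps)
    ultimately have "(\<lambda>n. c (Suc n) * x ^ Suc n) sums ((?S - t 0 * x ^ 0 - x * ?S + c 0 * x ^ 0) - c 0 * x ^ 0)"
      by simp
    hence "(\<lambda>n. c n * x ^ n) sums (?S - t 0 * x ^ 0 - x * ?S + c 0 * x ^ 0)"
      by (subst sums_Suc_iff[symmetric]) simp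
    hence "(\<Sum>n. c n * x ^ n) = ?S - t 0 * x ^ 0 - x * ?S + c 0 * x ^ 0" by (simp add: sums_iff)
    thus ?thesis using sm by (simp add: t_def algebra_simps)
  qed
  show ?thesis
  proof (rule tendstoI)
    fix \<epsilon> :: real assume \<epsilon>: "\<epsilon> > 0"
    obtain N where N: "\<And>n. n \<ge> N \<Longrightarrow> \<bar>t n\<bar> < \<epsilon> / 2"
      using LIMSEQ_D[OF t0, of "\<epsilon> / 2"] \<epsilon> by auto
    have bnd: "\<bar>(\<Sum>n. c n * x ^ n) - L\<bar> \<le> (1 - x) * (B * real N) + \<epsilon> / 2" if x: "0 \<le> x" "x < 1" for x
    proof -
      note k = key[OF x]
      have *: "\<bar>\<Sum>n. t n * x ^ n\<bar> \<le> (\<Sum>n. \<bar>t n\<bar> * x ^ n)"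
        using summable_rabs[of "\<lambda>n. t n * x ^ n"] k x by (simp add: abs_mult power_abs)
      \<comment> \<open>Majorant of |t_n| x^n: the first N terms are bounded by B, the others by
        \<epsilon>/2 times a geometric series. The prefactor 1 - x kills the former in the limit and
        cancels the sum 1/(1 - x) of the latter.\<close>
      have g: "(\<lambda>n. (if n \<in> {..<N} then B else 0) + \<epsilon> / 2 * x ^ n) sums (B * real N + \<epsilon> / 2 * (1 / (1 - x)))"
        using sums_If_finite_set[of "{..<N}" "\<lambda>_. B"] x
        by (intro sums_add sums_mult geometric_sums) (auto simp: mult.commute)
      have "(\<Sum>n. \<bar>t n\<bar> * x ^ n) \<le> (\<Sum>n. (if n \<in> {..<N} then B else 0) + \<epsilon> / 2 * x ^ n)"
      proof (rule suminf_le)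
        fix n
        show "\<bar>t n\<bar> * x ^ n \<le> (if n \<in> {..<N} then B else 0) + \<epsilon> / 2 * x ^ n"
        proof (cases "n < N")
          case True
          have "\<bar>t n\<bar> * x ^ n \<le> B * 1"
            using B x by (intro mult_mono power_le_one) auto
          moreover have "\<epsilon> / 2 * x ^ n \<ge> 0" using \<epsilon> x by simp
          ultimately show ?thesis using True by simp
        next
          case False
          thus ?thesis using N[of n] x mult_right_mono[of "\<bar>t n\<bar>" "\<epsilon> / 2" "x ^ n"] by auto
        qed
      qed (use k g in \<open>auto simp: sums_iff\<close>)
      also have "\<dots> = B * real N + \<epsilon> / 2 * (1 / (1 - x))" using g by (simp add: sums_iff)
      finally have "\<bar>(\<Sum>n. c n * x ^ n) - L\<bar> \<le> (1 - x) * (B * real N + \<epsilon> / 2 * (1 / (1 - x)))"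
        using * k x by (auto simp: abs_mult intro!: mult_left_mono)
      also have "\<dots> = (1 - x) * (B * real N) + \<epsilon> / 2" using x by (simp add: field_simps)
      finally show ?thesis .
    qed
    have "((\<lambda>x. (1 - x) * (B * real N)) \<longlongrightarrow> (1 - 1) * (B * real N)) (at_left 1)"
      by (intro tendsto_intros)
    hence "eventually (\<lambda>x. (1 - x) * (B * real N) < \<epsilon> / 2) (at_left 1)"
      using \<epsilon> by (intro order_tendstoD) auto
    moreover have "eventually (\<lambda>x::real. 0 \<le> x \<and> x < 1) (at_left 1)"
      using eventually_at_left_real[of 0 "1::real"] by (auto elim: eventually_mono)
    ultimately show "eventually (\<lambda>x. dist (\<Sum>n. c n * x ^ n) L < \<epsilon>) (at_left 1)"
      by eventually_elim (use bnd in \<open>force simp: dist_real_def\<close>)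
  qed
qed

text \<open>The coefficients of the word have the truncated Euler sums as partial sums, so Abel's
  theorem gives the limit of the iterated integral at 1, and the regularizing polynomial must be
  that constant.\<close>

lemma zeta_sh_convergent:
  assumes "\<forall>x\<in>set ((s, b) # rest). 1 \<le> fst x" and "(s, b) \<noteq> (1, False)"
  shows "zeta_sh ((s, b) # rest) = zc ((s, b) # rest)"
proof -
  let ?i = "(s, b) # rest"
  have "(\<lambda>n. \<Sum>m<Suc n. word_coeff (word ?i) m) \<longlonglongrightarrow> euler_zeta ?i"
    using esum_trunc_convergent(1)[OF assms] sum_word_coeff_word[OF assms(1)] by simp
  hence "word_coeff (word ?i) sums euler_zeta ?i"
    unfolding sums_def by (rule LIMSEQ_imp_Suc)
  from abel_limit[OF this] have "(word_series (word ?i) \<longlongrightarrow> euler_zeta ?i) (at_left 1)"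
    by (simp add: word_series_def[abs_def])
  moreover have "filterlim (\<lambda>\<epsilon>::real. 1 - \<epsilon>) (at_left 1) (at_right 0)"
    using eventually_at_right_real[of 0 "1::real"]
    by (auto simp: filterlim_at intro!: tendsto_eq_intros elim!: eventually_mono)
  ultimately have "((\<lambda>\<epsilon>. word_series (word ?i) (1 - \<epsilon>)) \<longlongrightarrow> euler_zeta ?i) (at_right 0)"
    by (rule filterlim_compose)
  hence "((\<lambda>\<epsilon>. word_series (word ?i) (1 - \<epsilon>) - poly (zc ?i) (- ln \<epsilon>)) \<longlongrightarrow> 0) (at_right 0)"
    by (simp add: zc_def LIM_zero_iff)
  from poly_asymptotics_unique[OF filterlim_minus_ln_at_right_0 trivial_limit_at_right_real
      asymp_polyD[OF asymp_poly_word_series] this]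
  show ?thesis .
qed

section \<open>Shuffle product of three polylogarithms\<close>

definition comps2 :: "nat \<Rightarrow> (nat \<times> nat) set" where
  "comps2 w = {(a, b). a \<ge> 1 \<and> b \<ge> 1 \<and> a + b = w}"

lemma finite_comps2 [simp]: "finite (comps2 w)"
  by (rule finite_subset[of _ "{..w} \<times> {..w}"]) (auto simp: comps2_def)

lemma finite_comps3 [simp]: "finite (comps3 w)"
  by (rule finite_subset[of _ "{..w} \<times> {..w} \<times> {..w}"]) (auto simp: comps3_def)

lemma sum_comps2_Suc_fst:
  assumes "w \<ge> 1"
  shows "(\<Sum>(a, b)\<in>comps2 (Suc w). f a b) = (\<Sum>(a, b)\<in>comps2 w. f (Suc a) b) + f 1 w"
proof -
  have "comps2 (Suc w) = (\<lambda>(a, b). (Suc a, b)) ` comps2 w \<union> {(1, w)}"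
  proof (intro equalityI subsetI)
    fix x assume "x \<in> comps2 (Suc w)"
    then obtain a b where x: "x = (a, b)" "a \<ge> 1" "b \<ge> 1" "a + b = Suc w" by (auto simp: comps2_def)
    show "x \<in> (\<lambda>(a, b). (Suc a, b)) ` comps2 w \<union> {(1, w)}"
    proof (cases "a = 1")
      case False
      hence "(a - 1, b) \<in> comps2 w" "x = (\<lambda>(a, b). (Suc a, b)) (a - 1, b)" using x by (auto simp: comps2_def)
      thus ?thesis by blast
    qed (use x in auto)
  qed (use assms in \<open>auto simp: comps2_def\<close>)
  moreover have "(1, w) \<notin> (\<lambda>(a, b). (Suc a, b)) ` comps2 w" by (auto simp: comps2_def)
  moreover have "inj_on (\<lambda>(a, b). (Suc a, b)) (comps2 w)" by (auto simp: inj_on_def)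
  ultimately show ?thesis by (simp add: sum.reindex case_prod_unfold add.commute)
qed

lemma sum_comps2_swap: "(\<Sum>(a, b)\<in>comps2 w. f a b) = (\<Sum>(a, b)\<in>comps2 w. f b a)"
  by (rule sum.reindex_bij_witness[of _ prod.swap prod.swap]) (auto simp: comps2_def)

lemma sum_comps3_Suc_1:
  "(\<Sum>(a, b, c)\<in>comps3 (Suc w). f a b c) =
     (\<Sum>(a, b, c)\<in>comps3 w. f (Suc a) b c) + (\<Sum>(b, c)\<in>comps2 w. f 1 b c)"
proof -
  let ?g = "\<lambda>(a, b, c). (Suc a, b, c)" and ?h = "\<lambda>(b, c). (1::nat, b, c)"
  have "comps3 (Suc w) = ?g ` comps3 w \<union> ?h ` comps2 w"
  proof (intro equalityI subsetI)
    fix x assume "x \<in> comps3 (Suc w)"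
    then obtain a b c where x: "x = (a, b, c)" "a \<ge> 1" "b \<ge> 1" "c \<ge> 1" "a + b + c = Suc w"
      by (auto simp: comps3_def)
    show "x \<in> ?g ` comps3 w \<union> ?h ` comps2 w"
    proof (cases "a = 1")
      case True
      hence "(b, c) \<in> comps2 w" "x = ?h (b, c)" using x by (auto simp: comps2_def)
      thus ?thesis by blast
    next
      case False
      hence "(a - 1, b, c) \<in> comps3 w" "x = ?g (a - 1, b, c)" using x by (auto simp: comps3_def)
      thus ?thesis by blast
    qed
  qed (auto simp: comps2_def comps3_def)
  moreover have "?g ` comps3 w \<inter> ?h ` comps2 w = {}" by (auto simp: comps2_def comps3_def)
  moreover have "inj_on ?g (comps3 w)" "inj_on ?h (comps2 w)" by (auto simp: inj_on_def)
  ultimately show ?thesis by (simp add: sum.union_disjoint sum.reindex case_prod_unfold)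
qed

lemma sum_comps3_rotate: "(\<Sum>(a, b, c)\<in>comps3 w. f a b c) = (\<Sum>(a, b, c)\<in>comps3 w. f b c a)"
  by (rule sum.reindex_bij_witness[of _ "\<lambda>(a, b, c). (b, c, a)" "\<lambda>(a, b, c). (c, a, b)"])
     (auto simp: comps3_def)

lemma sum_comps3_swap: "(\<Sum>(a, b, c)\<in>comps3 w. f a b c) = (\<Sum>(a, b, c)\<in>comps3 w. f b a c)"
  by (rule sum.reindex_bij_witness[of _ "\<lambda>(a, b, c). (b, a, c)" "\<lambda>(a, b, c). (b, a, c)"])
     (auto simp: comps3_def)

lemma sum_comps3_Suc_2:
  "(\<Sum>(a, b, c)\<in>comps3 (Suc w). f a b c) =
     (\<Sum>(a, b, c)\<in>comps3 w. f a (Suc b) c) + (\<Sum>(a, c)\<in>comps2 w. f a 1 c)"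
  using sum_comps3_Suc_1[of "\<lambda>a b c. f b a c" w] sum_comps3_swap[of f "Suc w"]
    sum_comps3_swap[of "\<lambda>a b c. f a (Suc b) c" w] by simp

lemma sum_comps3_Suc_3:
  "(\<Sum>(a, b, c)\<in>comps3 (Suc w). f a b c) =
     (\<Sum>(a, b, c)\<in>comps3 w. f a b (Suc c)) + (\<Sum>(a, b)\<in>comps2 w. f a b 1)"
  using sum_comps3_Suc_1[of "\<lambda>a b c. f b c a" w] sum_comps3_rotate[of f "Suc w"]
    sum_comps3_rotate[of "\<lambda>a b c. f a b (Suc c)" w] by simp

lemma comps_small: "comps2 0 = {}" "comps2 1 = {}" "comps3 0 = {}"
  by (auto simp: comps2_def comps3_def)

text \<open>Here z is the letter itself, not the quotient of neighbouring letters that an index of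
  an Euler sum records. A shuffle permutes letters, so this is the parametrization in which it is
  symmetric.\<close>

definition block :: "nat \<Rightarrow> real \<Rightarrow> real list \<Rightarrow> real list" where
  "block s z as = replicate (s - 1) 0 @ z # as"

lemma admissible_block: "admissible as \<Longrightarrow> z = 1 \<or> z = -1 \<Longrightarrow> admissible (block s z as)"
  unfolding block_def by (rule admissible_replicate) auto

lemma word_coeff_block_0 [simp]: "word_coeff (block s z as) 0 = 0"
  by (cases "s - 1") (auto simp: block_def)

lemma block_1_deriv:
  assumes "admissible as" "z = 1 \<or> z = -1" "0 < x" "x < 1"
  shows "(word_series (block 1 z as) has_real_derivative form z x * word_series as x) (at x)"
  unfolding block_def using assms by (auto intro!: word_series_Cons_deriv)

lemma block_Suc_deriv:
  assumes "admissible as" "z = 1 \<or> z = -1" "0 < x" "x < 1" "s \<ge> 1"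
  shows "(word_series (block (Suc s) z as) has_real_derivative word_series (block s z as) x / x) (at x)"
proof -
  have "block (Suc s) z as = 0 # block s z as" using assms(5) by (cases s) (auto simp: block_def)
  moreover have "block s z as \<noteq> []" by (simp add: block_def)
  ultimately show ?thesis
    using word_series_Cons_deriv[of 0 "block s z as" x] admissible_block[OF assms(1,2), of s] assms
    by (simp add: form_def)
qed

definition block_deriv :: "nat \<Rightarrow> real \<Rightarrow> real list \<Rightarrow> real \<Rightarrow> real" where
  "block_deriv s z as x =
     (if s = 1 then form z x * word_series as x else word_series (block (s - 1) z as) x / x)"

lemma has_block_deriv:
  assumes "admissible as" "z = 1 \<or> z = -1" "0 < x" "x < 1" "s \<ge> 1"
  shows "(word_series (block s z as) has_real_derivative block_deriv s z as x) (at x)"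
  using assms block_1_deriv[of as z x] block_Suc_deriv[of as z x "s - 1"]
  by (cases "s = 1") (auto simp: block_deriv_def)

lemma block_deriv_1 [simp]: "block_deriv (Suc 0) z as x = form z x * word_series as x"
  and block_deriv_Suc: "s \<ge> 1 \<Longrightarrow> block_deriv (Suc s) z as x = word_series (block s z as) x / x"
  by (auto simp: block_deriv_def)

section \<open>Differential equations for products of polylogarithms\<close>

abbreviation polylog :: "nat \<Rightarrow> real \<Rightarrow> real \<Rightarrow> real" where
  "polylog s z \<equiv> word_series (block s z [])"

definition weighted2 :: "nat \<Rightarrow> real \<Rightarrow> real \<Rightarrow> real \<Rightarrow> real" where
  "weighted2 w z1 z2 x = (\<Sum>(b, c)\<in>comps2 w. 2 ^ (b - 1) * word_series (block b z1 (block c z2 [])) x)"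

definition weighted3 :: "nat \<Rightarrow> real \<Rightarrow> real \<Rightarrow> real \<Rightarrow> real \<Rightarrow> real" where
  "weighted3 w z1 z2 z3 x = (\<Sum>(a, b, c)\<in>comps3 w.
     3 ^ (a - 1) * 2 ^ (b - 1) * word_series (block a z1 (block b z2 (block c z3 []))) x)"

lemma comps2_ge_1: "p \<in> comps2 w \<Longrightarrow> fst p \<ge> 1" "p \<in> comps2 w \<Longrightarrow> snd p \<ge> 1"
  by (auto simp: comps2_def)

lemma comps3_ge_1: "p \<in> comps3 w \<Longrightarrow> fst p \<ge> 1" "p \<in> comps3 w \<Longrightarrow> fst (snd p) \<ge> 1"
  "p \<in> comps3 w \<Longrightarrow> snd (snd p) \<ge> 1"
  by (auto simp: comps3_def)

context
  fixes x :: real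
  assumes x: "0 < x" "x < 1"
begin

lemma weighted2_deriv:
  assumes "z1 = 1 \<or> z1 = -1" "z2 = 1 \<or> z2 = -1" "w \<ge> 1"
  shows "(weighted2 (Suc w) z1 z2 has_real_derivative
           2 * weighted2 w z1 z2 x / x + form z1 x * polylog w z2 x) (at x)"
proof -
  have "((\<lambda>x. \<Sum>(b, c)\<in>comps2 (Suc w). 2 ^ (b - 1) * word_series (block b z1 (block c z2 [])) x)
      has_real_derivative (\<Sum>(b, c)\<in>comps2 (Suc w). 2 ^ (b - 1) * block_deriv b z1 (block c z2 []) x)) (at x)"
    unfolding case_prod_unfold
    by (intro DERIV_sum DERIV_cmult has_block_deriv admissible_block) (use assms x comps2_ge_1 in auto)
  also have "(\<Sum>(b, c)\<in>comps2 (Suc w). 2 ^ (b - 1) * block_deriv b z1 (block c z2 []) x) =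
      (\<Sum>(b, c)\<in>comps2 w. 2 ^ b * block_deriv (Suc b) z1 (block c z2 []) x) + form z1 x * polylog w z2 x"
    by (subst sum_comps2_Suc_fst[OF assms(3)]) simp
  also have "(\<Sum>(b, c)\<in>comps2 w. 2 ^ b * block_deriv (Suc b) z1 (block c z2 []) x) = 2 * weighted2 w z1 z2 x / x"
    unfolding weighted2_def sum_distrib_left sum_divide_distrib
  proof (intro sum.cong refl, clarify)
    fix b c assume "(b, c) \<in> comps2 w"
    hence "b \<ge> 1" by (auto simp: comps2_def)
    thus "2 ^ b * block_deriv (Suc b) z1 (block c z2 []) x =
        2 * (2 ^ (b - 1) * word_series (block b z1 (block c z2 [])) x) / x"
      by (cases b) (auto simp: block_deriv_Suc)
  qed
  finally show ?thesis unfolding weighted2_def[abs_def] .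
qed

lemma weighted3_deriv:
  assumes "z1 = 1 \<or> z1 = -1" "z2 = 1 \<or> z2 = -1" "z3 = 1 \<or> z3 = -1"
  shows "(weighted3 (Suc w) z1 z2 z3 has_real_derivative
           3 * weighted3 w z1 z2 z3 x / x + form z1 x * weighted2 w z2 z3 x) (at x)"
proof -
  have "((\<lambda>x. \<Sum>(a, b, c)\<in>comps3 (Suc w). 3 ^ (a - 1) * 2 ^ (b - 1) * word_series (block a z1 (block b z2 (block c z3 []))) x)
      has_real_derivative (\<Sum>(a, b, c)\<in>comps3 (Suc w). 3 ^ (a - 1) * 2 ^ (b - 1) * block_deriv a z1 (block b z2 (block c z3 [])) x)) (at x)"
    unfolding case_prod_unfold
    by (intro DERIV_sum DERIV_cmult has_block_deriv admissible_block) (use assms x comps3_ge_1 in auto)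
  also have "(\<Sum>(a, b, c)\<in>comps3 (Suc w). 3 ^ (a - 1) * 2 ^ (b - 1) * block_deriv a z1 (block b z2 (block c z3 [])) x) =
      (\<Sum>(a, b, c)\<in>comps3 w. 3 ^ a * 2 ^ (b - 1) * block_deriv (Suc a) z1 (block b z2 (block c z3 [])) x)
      + form z1 x * weighted2 w z2 z3 x"
    by (subst sum_comps3_Suc_1) (simp add: weighted2_def sum_distrib_left case_prod_unfold mult_ac)
  also have "(\<Sum>(a, b, c)\<in>comps3 w. 3 ^ a * 2 ^ (b - 1) * block_deriv (Suc a) z1 (block b z2 (block c z3 [])) x)
      = 3 * weighted3 w z1 z2 z3 x / x"
    unfolding weighted3_def sum_distrib_left sum_divide_distrib
  proof (intro sum.cong refl, clarify)
    fix a b c assume "(a, b, c) \<in> comps3 w"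
    hence "a \<ge> 1" by (auto simp: comps3_def)
    thus "3 ^ a * 2 ^ (b - 1) * block_deriv (Suc a) z1 (block b z2 (block c z3 [])) x =
        3 * (3 ^ (a - 1) * 2 ^ (b - 1) * word_series (block a z1 (block b z2 (block c z3 []))) x) / x"
      by (cases a) (auto simp: block_deriv_Suc)
  qed
  finally show ?thesis unfolding weighted3_def[abs_def] .
qed

lemma polylog_product2_deriv:
  assumes z: "z1 = 1 \<or> z1 = -1" "z2 = 1 \<or> z2 = -1" and w: "w \<ge> 1"
  shows "((\<lambda>x. \<Sum>(p, q)\<in>comps2 (Suc w). polylog p z1 x * polylog q z2 x) has_real_derivative
           2 * (\<Sum>(p, q)\<in>comps2 w. polylog p z1 x * polylog q z2 x) / x
           + form z1 x * polylog w z2 x + form z2 x * polylog w z1 x) (at x)"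
proof -
  define L L' where "L = (\<lambda>z s. polylog s z x)" and "L' = (\<lambda>z s. block_deriv s z [] x)"
  have L'1: "L' z 1 = form z x" for z by (simp add: L'_def)
  have L'_Suc: "L' z (Suc s) = L z s / x" if "s \<ge> 1" for s z
    using that by (simp add: L'_def L_def block_deriv_Suc)
  have *: "(\<Sum>(p, q)\<in>comps2 (Suc w). L' z p * L t q) = (\<Sum>(p, q)\<in>comps2 w. L z p * L t q) / x + form z x * L t w" for z t
    unfolding sum_comps2_Suc_fst[OF w, of "\<lambda>p q. L' z p * L t q"] sum_divide_distrib L'1
    by (intro arg_cong2[of _ _ _ _ "(+)"] sum.cong refl) (auto simp: comps2_def L'_Suc)
  have "((\<lambda>x. \<Sum>(p, q)\<in>comps2 (Suc w). polylog p z1 x * polylog q z2 x) has_real_derivative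
      (\<Sum>(p, q)\<in>comps2 (Suc w). L' z1 p * L z2 q + L' z2 q * L z1 p)) (at x)"
    unfolding case_prod_unfold L_def L'_def
    by (intro DERIV_sum DERIV_mult has_block_deriv) (use z x comps2_ge_1 in auto)
  also have "(\<Sum>(p, q)\<in>comps2 (Suc w). L' z1 p * L z2 q + L' z2 q * L z1 p) =
     (\<Sum>(p, q)\<in>comps2 (Suc w). L' z1 p * L z2 q) + (\<Sum>(p, q)\<in>comps2 (Suc w). L' z2 p * L z1 q)"
    using sum_comps2_swap[of "\<lambda>p q. L' z2 p * L z1 q" "Suc w"]
    by (simp add: case_prod_unfold sum.distrib)
  also note *[of z1 z2]
  also have "(\<Sum>(p, q)\<in>comps2 (Suc w). L' z2 p * L z1 q) = (\<Sum>(p, q)\<in>comps2 w. L z1 p * L z2 q) / x + form z2 x * L z1 w"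
    unfolding * sum_comps2_swap[of "\<lambda>p q. L z1 p * L z2 q" w] by (simp add: mult.commute)
  finally show ?thesis unfolding L_def by (simp add: algebra_simps)
qed

text \<open>Differentiating a factor with exponent at least 2 lowers the exponent and divides by x.
  Summed over all exponents, each of the three factors thus reproduces the whole sum of weight w,
  which gives 3/x; an exponent 1 uses up the letter and leaves a product of the other two.\<close>

lemma polylog_product3_deriv:
  assumes z: "z1 = 1 \<or> z1 = -1" "z2 = 1 \<or> z2 = -1" "z3 = 1 \<or> z3 = -1"
  shows "((\<lambda>x. \<Sum>(p, q, r)\<in>comps3 (Suc w). polylog p z1 x * polylog q z2 x * polylog r z3 x) has_real_derivative
           3 * (\<Sum>(p, q, r)\<in>comps3 w. polylog p z1 x * polylog q z2 x * polylog r z3 x) / x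
           + form z1 x * (\<Sum>(p, q)\<in>comps2 w. polylog p z2 x * polylog q z3 x)
           + form z2 x * (\<Sum>(p, q)\<in>comps2 w. polylog p z1 x * polylog q z3 x)
           + form z3 x * (\<Sum>(p, q)\<in>comps2 w. polylog p z1 x * polylog q z2 x)) (at x)"
proof -
  define L L' where "L = (\<lambda>z s. polylog s z x)" and "L' = (\<lambda>z s. block_deriv s z [] x)"
  have L'1: "L' z 1 = form z x" for z by (simp add: L'_def)
  have L'_Suc: "L' z (Suc s) = L z s / x" if "s \<ge> 1" for s z
    using that by (simp add: L'_def L_def block_deriv_Suc)
  have "((\<lambda>x. \<Sum>(p, q, r)\<in>comps3 (Suc w). polylog p z1 x * polylog q z2 x * polylog r z3 x) has_real_derivative
      (\<Sum>(p, q, r)\<in>comps3 (Suc w). (L' z1 p * L z2 q + L' z2 q * L z1 p) * L z3 r + L' z3 r * (L z1 p * L z2 q))) (at x)"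
    unfolding case_prod_unfold L_def L'_def
    by (intro DERIV_sum DERIV_mult has_block_deriv) (use z x comps3_ge_1 in auto)
  also have "(\<Sum>(p, q, r)\<in>comps3 (Suc w). (L' z1 p * L z2 q + L' z2 q * L z1 p) * L z3 r + L' z3 r * (L z1 p * L z2 q)) =
     (\<Sum>(p, q, r)\<in>comps3 (Suc w). L' z1 p * L z2 q * L z3 r)
     + (\<Sum>(p, q, r)\<in>comps3 (Suc w). L z1 p * L' z2 q * L z3 r)
     + (\<Sum>(p, q, r)\<in>comps3 (Suc w). L z1 p * L z2 q * L' z3 r)"
    by (simp add: case_prod_unfold sum.distrib algebra_simps)
  also have "(\<Sum>(p, q, r)\<in>comps3 (Suc w). L' z1 p * L z2 q * L z3 r) =
      (\<Sum>(p, q, r)\<in>comps3 w. L z1 p * L z2 q * L z3 r) / x + form z1 x * (\<Sum>(p, q)\<in>comps2 w. L z2 p * L z3 q)"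
    unfolding sum_comps3_Suc_1[of "\<lambda>p q r. L' z1 p * L z2 q * L z3 r"] sum_divide_distrib sum_distrib_left L'1
    by (intro arg_cong2[of _ _ _ _ "(+)"] sum.cong refl) (auto simp: comps3_def L'_Suc)
  also have "(\<Sum>(p, q, r)\<in>comps3 (Suc w). L z1 p * L' z2 q * L z3 r) =
      (\<Sum>(p, q, r)\<in>comps3 w. L z1 p * L z2 q * L z3 r) / x + form z2 x * (\<Sum>(p, q)\<in>comps2 w. L z1 p * L z3 q)"
    unfolding sum_comps3_Suc_2[of "\<lambda>p q r. L z1 p * L' z2 q * L z3 r"] sum_divide_distrib sum_distrib_left L'1
    by (intro arg_cong2[of _ _ _ _ "(+)"] sum.cong refl) (auto simp: comps3_def L'_Suc)
  also have "(\<Sum>(p, q, r)\<in>comps3 (Suc w). L z1 p * L z2 q * L' z3 r) =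
      (\<Sum>(p, q, r)\<in>comps3 w. L z1 p * L z2 q * L z3 r) / x + form z3 x * (\<Sum>(p, q)\<in>comps2 w. L z1 p * L z2 q)"
    unfolding sum_comps3_Suc_3[of "\<lambda>p q r. L z1 p * L z2 q * L' z3 r"] sum_divide_distrib sum_distrib_left L'1
    by (intro arg_cong2[of _ _ _ _ "(+)"] sum.cong refl) (auto simp: comps3_def L'_Suc)
  finally show ?thesis unfolding L_def by (simp add: algebra_simps)
qed

end

text \<open>The derivatives at hand contain 1/x, so 0 is treated by continuity alone.\<close>

lemma eq_if_deriv_eq_on_unit_interval:
  fixes f g :: "real \<Rightarrow> real"
  assumes "\<And>x. 0 < x \<Longrightarrow> x < 1 \<Longrightarrow> (f has_real_derivative d x) (at x)"
    and "\<And>x. 0 < x \<Longrightarrow> x < 1 \<Longrightarrow> (g has_real_derivative d x) (at x)"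
    and "isCont f 0" "isCont g 0" "f 0 = g 0" "0 \<le> x" "x < 1"
  shows "f x = g x"
proof (cases "x = 0")
  case False
  have "(\<lambda>t. f t - g t) x = (\<lambda>t. f t - g t) 0"
  proof (rule DERIV_isconst_end[where f = "\<lambda>t. f t - g t"])
    show "0 < x" using False assms by simp
    have "isCont (\<lambda>t. f t - g t) t" if "t \<in> {0..x}" for t
      using that assms DERIV_isCont[OF assms(1)[of t]] DERIV_isCont[OF assms(2)[of t]]
      by (cases "t = 0") (auto intro!: continuous_intros)
    thus "continuous_on {0..x} (\<lambda>t. f t - g t)" by (intro continuous_at_imp_continuous_on) auto
    show "((\<lambda>t. f t - g t) has_real_derivative 0) (at t)" if "0 < t" "t < x" for t
      using DERIV_diff[OF assms(1)[of t] assms(2)[of t]] that assms by simp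
  qed
  thus ?thesis using assms by simp
qed (use assms in simp)

text \<open>Induction on the weight: both sides vanish at 0, and their derivatives at weight w + 1
  are the same expression in the sums of weight w.\<close>

lemma shuffle_product2:
  assumes z: "z1 = 1 \<or> z1 = -1" "z2 = 1 \<or> z2 = -1" and "0 \<le> x" "x < 1"
  shows "(\<Sum>(p, q)\<in>comps2 w. polylog p z1 x * polylog q z2 x) = weighted2 w z1 z2 x + weighted2 w z2 z1 x"
  using assms(3,4)
proof (induction w arbitrary: x)
  case 0
  show ?case by (simp add: weighted2_def comps_small)
next
  case (Suc w)
  show ?case
  proof (cases "w \<ge> 1")
    case False
    hence "comps2 (Suc w) = {}" by (auto simp: comps2_def)
    thus ?thesis by (simp add: weighted2_def)
  next
    case True
    show ?thesis
    proof (rule eq_if_deriv_eq_on_unit_interval[where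
          f = "\<lambda>x. \<Sum>(p, q)\<in>comps2 (Suc w). polylog p z1 x * polylog q z2 x" and
          g = "\<lambda>x. weighted2 (Suc w) z1 z2 x + weighted2 (Suc w) z2 z1 x"])
      fix t :: real assume t: "0 < t" "t < 1"
      show "((\<lambda>x. \<Sum>(p, q)\<in>comps2 (Suc w). polylog p z1 x * polylog q z2 x) has_real_derivative
           2 * (\<Sum>(p, q)\<in>comps2 w. polylog p z1 t * polylog q z2 t) / t
           + form z1 t * polylog w z2 t + form z2 t * polylog w z1 t) (at t)"
        by (rule polylog_product2_deriv[OF t z True])
      have "((\<lambda>x. weighted2 (Suc w) z1 z2 x + weighted2 (Suc w) z2 z1 x) has_real_derivative
          (2 * weighted2 w z1 z2 t / t + form z1 t * polylog w z2 t) + (2 * weighted2 w z2 z1 t / t + form z2 t * polylog w z1 t)) (at t)"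
        by (intro DERIV_add weighted2_deriv t z True)
      thus "((\<lambda>x. weighted2 (Suc w) z1 z2 x + weighted2 (Suc w) z2 z1 x) has_real_derivative
          2 * (\<Sum>(p, q)\<in>comps2 w. polylog p z1 t * polylog q z2 t) / t
           + form z1 t * polylog w z2 t + form z2 t * polylog w z1 t) (at t)"
        using t by (subst Suc.IH) (auto simp: algebra_simps add_divide_distrib)
    qed (use Suc.prems z in \<open>auto simp: weighted2_def[abs_def] case_prod_unfold
           intro!: continuous_intros isCont_word_series admissible_block\<close>)
  qed
qed

lemma shuffle_product3:
  assumes z: "z1 = 1 \<or> z1 = -1" "z2 = 1 \<or> z2 = -1" "z3 = 1 \<or> z3 = -1" and "0 \<le> x" "x < 1"
  shows "(\<Sum>(p, q, r)\<in>comps3 w. polylog p z1 x * polylog q z2 x * polylog r z3 x) =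
     weighted3 w z1 z2 z3 x + weighted3 w z1 z3 z2 x + weighted3 w z2 z1 z3 x
     + weighted3 w z2 z3 z1 x + weighted3 w z3 z1 z2 x + weighted3 w z3 z2 z1 x"
  using assms(4,5)
proof (induction w arbitrary: x)
  case 0
  show ?case by (simp add: weighted3_def comps_small)
next
  case (Suc w)
  show ?case
  proof (rule eq_if_deriv_eq_on_unit_interval[where
        f = "\<lambda>x. \<Sum>(p, q, r)\<in>comps3 (Suc w). polylog p z1 x * polylog q z2 x * polylog r z3 x" and
        g = "\<lambda>x. weighted3 (Suc w) z1 z2 z3 x + weighted3 (Suc w) z1 z3 z2 x + weighted3 (Suc w) z2 z1 z3 x
          + weighted3 (Suc w) z2 z3 z1 x + weighted3 (Suc w) z3 z1 z2 x + weighted3 (Suc w) z3 z2 z1 x"])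
    fix t :: real assume t: "0 < t" "t < 1"
    let ?d = "3 * (\<Sum>(p, q, r)\<in>comps3 w. polylog p z1 t * polylog q z2 t * polylog r z3 t) / t
           + form z1 t * (\<Sum>(p, q)\<in>comps2 w. polylog p z2 t * polylog q z3 t)
           + form z2 t * (\<Sum>(p, q)\<in>comps2 w. polylog p z1 t * polylog q z3 t)
           + form z3 t * (\<Sum>(p, q)\<in>comps2 w. polylog p z1 t * polylog q z2 t)"
    show "((\<lambda>x. \<Sum>(p, q, r)\<in>comps3 (Suc w). polylog p z1 x * polylog q z2 x * polylog r z3 x)
        has_real_derivative ?d) (at t)"
      by (rule polylog_product3_deriv[OF t z])
    have *: "((\<lambda>x. weighted3 (Suc w) z1 z2 z3 x + weighted3 (Suc w) z1 z3 z2 x + weighted3 (Suc w) z2 z1 z3 x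
     + weighted3 (Suc w) z2 z3 z1 x + weighted3 (Suc w) z3 z1 z2 x + weighted3 (Suc w) z3 z2 z1 x) has_real_derivative
        (3 * weighted3 w z1 z2 z3 t / t + form z1 t * weighted2 w z2 z3 t)
        + (3 * weighted3 w z1 z3 z2 t / t + form z1 t * weighted2 w z3 z2 t)
        + (3 * weighted3 w z2 z1 z3 t / t + form z2 t * weighted2 w z1 z3 t)
        + (3 * weighted3 w z2 z3 z1 t / t + form z2 t * weighted2 w z3 z1 t)
        + (3 * weighted3 w z3 z1 z2 t / t + form z3 t * weighted2 w z1 z2 t)
        + (3 * weighted3 w z3 z2 z1 t / t + form z3 t * weighted2 w z2 z1 t)) (at t)"
      by (intro DERIV_add weighted3_deriv t z)
    \<comment> \<open>The six terms with 3/t are merged by the induction hypothesis; those sharing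
      the same first letter are merged in pairs by \<open>shuffle_product2\<close>.\<close>
    have eq: "(3 * weighted3 w z1 z2 z3 t / t + form z1 t * weighted2 w z2 z3 t)
        + (3 * weighted3 w z1 z3 z2 t / t + form z1 t * weighted2 w z3 z2 t)
        + (3 * weighted3 w z2 z1 z3 t / t + form z2 t * weighted2 w z1 z3 t)
        + (3 * weighted3 w z2 z3 z1 t / t + form z2 t * weighted2 w z3 z1 t)
        + (3 * weighted3 w z3 z1 z2 t / t + form z3 t * weighted2 w z1 z2 t)
        + (3 * weighted3 w z3 z2 z1 t / t + form z3 t * weighted2 w z2 z1 t) = ?d"
      using t z by (simp add: Suc.IH shuffle_product2 distrib_left add_divide_distrib)
    show "((\<lambda>x. weighted3 (Suc w) z1 z2 z3 x + weighted3 (Suc w) z1 z3 z2 x + weighted3 (Suc w) z2 z1 z3 x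
     + weighted3 (Suc w) z2 z3 z1 x + weighted3 (Suc w) z3 z1 z2 x + weighted3 (Suc w) z3 z2 z1 x) has_real_derivative ?d) (at t)"
      using * unfolding eq .
  qed (use Suc.prems z in \<open>auto simp: weighted3_def[abs_def] case_prod_unfold
           intro!: continuous_intros isCont_word_series admissible_block\<close>)
qed

section \<open>From polylogarithms to regularized values\<close>

lemma block_eq_word: "block s (zsgn b) [] = word [(s, b)]"
  by (simp add: block_def word_def)

text \<open>Letters are a_k = z_1 ... z_k, so z_k is the product of the k-th letter and its
  predecessor; on booleans this product is exclusive or, written as inequality. The first letter is
  its own sign.\<close>

lemma block3_eq_word:
  "block a (zsgn s1) (block b (zsgn s2) (block c (zsgn s3) [])) =
     word [(a, s1), (b, s1 \<noteq> s2), (c, s2 \<noteq> s3)]"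
  by (cases s1; cases s2; cases s3) (auto simp: block_def word_def)

definition weighted_zeta_sh :: "nat \<Rightarrow> bool \<Rightarrow> bool \<Rightarrow> bool \<Rightarrow> real poly" where
  "weighted_zeta_sh w s1 s2 s3 = (\<Sum>(a, b, c)\<in>comps3 w. smult (3 ^ (a - 1) * 2 ^ (b - 1))
     (zeta_sh [(a, s1), (b, s1 \<noteq> s2), (c, s2 \<noteq> s3)]))"

text \<open>The only divergent index of depth 1 is an unbarred 1. Its iterated integral is exactly
  -ln eps and its truncated sum is H_M = ln M + gamma + o(1), so both regularizations give T; the
  normalization by gamma makes them agree.\<close>

lemma zeta_sh_eq_zeta_st_depth1: "s \<ge> 1 \<Longrightarrow> zeta_sh [(s, b)] = zeta_st [(s, b)]"
proof (cases "(s, b) = (1, False)")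
  case True
  have "word_series [1] x = - ln (1 - x)" if "0 \<le> x" "x < 1" for x
  proof (rule eq_if_deriv_eq_on_unit_interval[OF _ _ _ _ _ that])
    show "(word_series [1] has_real_derivative form 1 x * word_series [] x) (at x)" if "0 < x" "x < 1" for x
      by (rule word_series_Cons_deriv) (use that in auto)
    show "((\<lambda>x. - ln (1 - x)) has_real_derivative form 1 x * word_series [] x) (at x)" if "0 < x" "x < 1" for x
      using that by (auto intro!: derivative_eq_intros simp: form_def)
  qed (auto intro!: isCont_word_series continuous_intros)
  hence ev: "eventually (\<lambda>\<epsilon>. word_series (word [(1, False)]) (1 - \<epsilon>) - poly [:0, 1:] (- ln \<epsilon>) = 0) (at_right 0)"
    using eventually_at_right_real[of 0 "1::real"] by (auto simp: word_def elim!: eventually_mono)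
  have "((\<lambda>\<epsilon>. word_series (word [(1, False)]) (1 - \<epsilon>) - poly [:0, 1:] (- ln \<epsilon>)) \<longlongrightarrow> 0) (at_right 0)"
    by (rule tendsto_eventually[OF ev])
  with asymp_polyD[OF asymp_poly_word_series[of "[(1, False)]"]] show ?thesis
    using True zeta_st_1 poly_asymptotics_unique[OF filterlim_minus_ln_at_right_0 trivial_limit_at_right_real]
    by (metis prod.inject)
next
  case False
  assume "s \<ge> 1"
  thus ?thesis using False zeta_sh_convergent[of s b "[]"] esum_trunc_convergent(2)[of s b "[]"] by simp
qed

theorem shuffle_product3_regularized:
  "(\<Sum>(p, q, r)\<in>comps3 w. zeta_st [(p, s1)] * zeta_st [(q, s2)] * zeta_st [(r, s3)]) =
     weighted_zeta_sh w s1 s2 s3 + weighted_zeta_sh w s1 s3 s2 + weighted_zeta_sh w s2 s1 s3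
     + weighted_zeta_sh w s2 s3 s1 + weighted_zeta_sh w s3 s1 s2 + weighted_zeta_sh w s3 s2 s1"
    (is "?L = ?R")
proof -
  let ?\<rho> = "\<lambda>\<epsilon>::real. - ln \<epsilon>" and ?F = "at_right (0::real)"
  have W: "asymp_poly ?F ?\<rho> (\<lambda>\<epsilon>. weighted3 w (zsgn s1) (zsgn s2) (zsgn s3) (1 - \<epsilon>)) (weighted_zeta_sh w s1 s2 s3)"
    for s1 s2 s3
    unfolding weighted3_def weighted_zeta_sh_def case_prod_unfold block3_eq_word
    by (intro asymp_poly_sum asymp_poly_smult asymp_poly_word_series)
  have "asymp_poly ?F ?\<rho> (\<lambda>\<epsilon>. \<Sum>(p, q, r)\<in>comps3 w. polylog p (zsgn s1) (1 - \<epsilon>) * polylog q (zsgn s2) (1 - \<epsilon>) * polylog r (zsgn s3) (1 - \<epsilon>))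
     (\<Sum>(p, q, r)\<in>comps3 w. zeta_sh [(p, s1)] * zeta_sh [(q, s2)] * zeta_sh [(r, s3)])"
    unfolding case_prod_unfold block_eq_word
    by (intro asymp_poly_sum asymp_poly_mult asymp_poly_word_series)
  also have "(\<Sum>(p, q, r)\<in>comps3 w. zeta_sh [(p, s1)] * zeta_sh [(q, s2)] * zeta_sh [(r, s3)]) = ?L"
    by (intro sum.cong refl) (auto simp: comps3_def zeta_sh_eq_zeta_st_depth1)
  finally have 1: "asymp_poly ?F ?\<rho> (\<lambda>\<epsilon>. \<Sum>(p, q, r)\<in>comps3 w. polylog p (zsgn s1) (1 - \<epsilon>) * polylog q (zsgn s2) (1 - \<epsilon>) * polylog r (zsgn s3) (1 - \<epsilon>)) ?L" .
  have 2: "asymp_poly ?F ?\<rho> (\<lambda>\<epsilon>. weighted3 w (zsgn s1) (zsgn s2) (zsgn s3) (1 - \<epsilon>)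
     + weighted3 w (zsgn s1) (zsgn s3) (zsgn s2) (1 - \<epsilon>) + weighted3 w (zsgn s2) (zsgn s1) (zsgn s3) (1 - \<epsilon>)
     + weighted3 w (zsgn s2) (zsgn s3) (zsgn s1) (1 - \<epsilon>) + weighted3 w (zsgn s3) (zsgn s1) (zsgn s2) (1 - \<epsilon>)
     + weighted3 w (zsgn s3) (zsgn s2) (zsgn s1) (1 - \<epsilon>)) ?R"
    by (intro asymp_poly_add W)
  have "eventually (\<lambda>\<epsilon>. (\<Sum>(p, q, r)\<in>comps3 w. polylog p (zsgn s1) (1 - \<epsilon>) * polylog q (zsgn s2) (1 - \<epsilon>) * polylog r (zsgn s3) (1 - \<epsilon>))
     = weighted3 w (zsgn s1) (zsgn s2) (zsgn s3) (1 - \<epsilon>)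
     + weighted3 w (zsgn s1) (zsgn s3) (zsgn s2) (1 - \<epsilon>) + weighted3 w (zsgn s2) (zsgn s1) (zsgn s3) (1 - \<epsilon>)
     + weighted3 w (zsgn s2) (zsgn s3) (zsgn s1) (1 - \<epsilon>) + weighted3 w (zsgn s3) (zsgn s1) (zsgn s2) (1 - \<epsilon>)
     + weighted3 w (zsgn s3) (zsgn s2) (zsgn s1) (1 - \<epsilon>)) ?F"
    using eventually_at_right_real[OF zero_less_one]
    by eventually_elim (use zsgn_cases in \<open>auto intro!: shuffle_product3\<close>)
  from asymp_polyD[OF asymp_poly_cong[OF 1 this]] asymp_polyD[OF 2]
  show ?thesis by (rule poly_asymptotics_unique[OF filterlim_minus_ln_at_right_0 trivial_limit_at_right_real])
qed

section \<open>Products of three truncated sums\<close>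

lemma sum_comps2_geometric:
  fixes y z :: real
  assumes "y > 0" "z > 0"
  shows "(\<Sum>(q, r)\<in>comps2 (Suc k). 1 / (y ^ q * z ^ r)) =
     (if y = z then real k / y ^ Suc k else (1 / y ^ k - 1 / z ^ k) / (z - y))"
proof (induction k)
  case 0
  show ?case using comps_small by simp
next
  case (Suc k)
  have "(\<Sum>(q, r)\<in>comps2 (Suc (Suc k)). 1 / (y ^ q * z ^ r)) =
      (\<Sum>(q, r)\<in>comps2 (Suc k). 1 / (y ^ q * z ^ r)) / y + 1 / (y * z ^ Suc k)"
    by (subst sum_comps2_Suc_fst) (auto simp: case_prod_unfold sum_divide_distrib mult_ac)
  also have "\<dots> = (if y = z then real (Suc k) / y ^ Suc (Suc k) else (1 / y ^ Suc k - 1 / z ^ Suc k) / (z - y))"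
  proof (cases "y = z")
    case True
    thus ?thesis unfolding Suc.IH using assms by (simp add: add_divide_distrib mult_ac)
  next
    case False
    have "(1 / y ^ k - 1 / z ^ k) / (z - y) / y + 1 / (y * z ^ Suc k) = (1 / y ^ Suc k - 1 / z ^ Suc k) / (z - y)"
    proof -
      define Y Z where "Y = 1 / y ^ k" and "Z = 1 / z ^ k"
      have "(Y - Z) / (z - y) / y + Z / (y * z) = (Y / y - Z / z) / (z - y)"
        using assms False by (simp add: divide_simps) (simp add: algebra_simps)
      thus ?thesis by (simp add: Y_def Z_def mult_ac)
    qed
    thus ?thesis using False by (simp only: Suc.IH if_False)
  qed
  finally show ?case .
qed

text \<open>For w \<ge> 3 this is the complete homogeneous symmetric polynomial of degree w - 3 in
  1/x, 1/y, 1/z, divided by xyz. The closed forms below are the classical evaluations of it,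
  according to which arguments coincide.\<close>

definition inv_monomials3 :: "nat \<Rightarrow> real \<Rightarrow> real \<Rightarrow> real \<Rightarrow> real" where
  "inv_monomials3 w x y z = (\<Sum>(p, q, r)\<in>comps3 w. 1 / (x ^ p * y ^ q * z ^ r))"

lemma inv_monomials3_Suc:
  "inv_monomials3 (Suc w) x y z = inv_monomials3 w x y z / x + (\<Sum>(q, r)\<in>comps2 w. 1 / (y ^ q * z ^ r)) / x"
  unfolding inv_monomials3_def
  by (subst sum_comps3_Suc_1) (simp add: case_prod_unfold sum_divide_distrib mult_ac)

lemma inv_monomials3_base: "inv_monomials3 (Suc (Suc 0)) x y z = 0"
proof -
  have "comps3 (Suc (Suc 0)) = {}" by (auto simp: comps3_def)
  thus ?thesis by (simp add: inv_monomials3_def)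
qed

lemma inv_monomials3_rotate: "inv_monomials3 w x y z = inv_monomials3 w y z x"
  unfolding inv_monomials3_def
  using sum_comps3_rotate[of "\<lambda>p q r. 1 / (y ^ p * z ^ q * x ^ r)" w] 
    sum_comps3_rotate[of "\<lambda>p q r. 1 / (x ^ p * y ^ q * z ^ r)" w]
    sum_comps3_rotate[of "\<lambda>p q r. 1 / (x ^ q * y ^ r * z ^ p)" w]
  by (simp add: mult_ac)

text \<open>The induction separates first exponent 1 from larger ones, by
  \<open>inv_monomials3_Suc\<close>. It can start at weight 2, where the left side is an empty sum
  and the three fractions on the right add up to 0.\<close>

lemma inv_monomials3_distinct:
  assumes "x > 0" "y > 0" "z > 0" "x \<noteq> y" "y \<noteq> z" "x \<noteq> z"
  shows "inv_monomials3 (Suc (Suc u)) x y z =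
     1 / x ^ u / ((y - x) * (z - x)) + 1 / y ^ u / ((x - y) * (z - y)) + 1 / z ^ u / ((x - z) * (y - z))"
proof (induction u)
  case 0
  show ?case using assms by (simp add: inv_monomials3_base divide_simps) (simp add: algebra_simps)
next
  case (Suc u)
  define X Y Z where "X = 1 / x ^ Suc u" and "Y = 1 / y ^ Suc u" and "Z = 1 / z ^ Suc u"
  have XYZ: "1 / x ^ u = X * x" "1 / y ^ u = Y * y" "1 / z ^ u = Z * z"
    using assms by (auto simp: X_def Y_def Z_def)
  have "inv_monomials3 (Suc (Suc (Suc u))) x y z =
      (X * x / ((y - x) * (z - x)) + Y * y / ((x - y) * (z - y)) + Z * z / ((x - z) * (y - z))) / x + (Y - Z) / (z - y) / x"
    using assms unfolding inv_monomials3_Suc[of "Suc (Suc u)"] Suc.IH sum_comps2_geometric[OF assms(2,3)] XYZ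
    by (simp add: Y_def Z_def)
  also have "\<dots> = X / ((y - x) * (z - x)) + (Y * y / ((x - y) * (z - y)) + Y / (z - y)) / x
      + (Z * z / ((x - z) * (y - z)) - Z / (z - y)) / x"
    using assms by (simp add: add_divide_distrib diff_divide_distrib)
  also have "Y * y / ((x - y) * (z - y)) + Y / (z - y) = x * (Y / ((x - y) * (z - y)))"
    using assms by (simp add: divide_simps) (simp add: algebra_simps)
  also have "Z * z / ((x - z) * (y - z)) - Z / (z - y) = x * (Z / ((x - z) * (y - z)))"
    using assms by (simp add: divide_simps) (simp add: algebra_simps)
  finally show ?case using assms by (simp add: X_def Y_def Z_def)
qed

text \<open>The confluent case y = x of the previous formula: the two fractions that become singular
  merge into minus the derivative of x^(-u)/(z - x).\<close>

lemma inv_monomials3_pair: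
  assumes "x > 0" "z > 0" "x \<noteq> z"
  shows "inv_monomials3 (Suc (Suc u)) x x z =
     real u / x ^ Suc u / (z - x) - 1 / x ^ u / (z - x) ^ 2 + 1 / z ^ u / (z - x) ^ 2"
proof (induction u)
  case 0
  show ?case using assms by (simp add: inv_monomials3_base)
next
  case (Suc u)
  define X Z where "X = 1 / x ^ Suc u" and "Z = 1 / z ^ Suc u"
  have XZ: "1 / x ^ u = X * x" "1 / z ^ u = Z * z" "real u / x ^ Suc u = real u * X"
    using assms by (auto simp: X_def Z_def)
  have "inv_monomials3 (Suc (Suc (Suc u))) x x z =
      (real u * X / (z - x) - X * x / (z - x) ^ 2 + Z * z / (z - x) ^ 2) / x + (X - Z) / (z - x) / x"
    using assms unfolding inv_monomials3_Suc[of "Suc (Suc u)"] Suc.IH sum_comps2_geometric[OF assms(1,2)] XZ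
    by (simp add: X_def Z_def)
  also have "\<dots> = (real u + 1) * (X / x) / (z - x) - X / (z - x) ^ 2 + (Z * z / (z - x) ^ 2 - Z / (z - x)) / x"
    using assms by (simp add: add_divide_distrib diff_divide_distrib distrib_left distrib_right mult_ac)
  also have "Z * z / (z - x) ^ 2 - Z / (z - x) = x * (Z / (z - x) ^ 2)"
    using assms by (simp add: divide_simps power2_eq_square) (simp add: algebra_simps)
  finally show ?case using assms by (simp add: X_def Z_def mult_ac add.commute)
qed

text \<open>All monomials coincide, and u + 2 has \<open>Suc u choose 2\<close> compositions into
  three positive parts.\<close>

lemma inv_monomials3_equal:
  assumes "x > 0"
  shows "inv_monomials3 (Suc (Suc u)) x x x = real (Suc u choose 2) / x ^ Suc (Suc u)"
proof (induction u)
  case 0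
  show ?case by (simp add: inv_monomials3_base)
next
  case (Suc u)
  have "real (Suc (Suc u) choose 2) = real (Suc u choose 2) + real (Suc u)"
    by (simp add: numeral_2_eq_2)
  thus ?case unfolding inv_monomials3_Suc[of "Suc (Suc u)"] Suc.IH sum_comps2_geometric[OF assms assms]
    using assms by (simp add: add_divide_distrib mult_ac del: of_nat_Suc)
qed

text \<open>Division by zero yields 0, so the terms of the partial fraction decomposition for distinct
  arguments drop out where their denominators vanish, and a single formula covers all coincidences.\<close>

lemma inv_monomials3_partial_fractions:
  fixes x y z :: real and u :: nat
  assumes "x > 0" "y > 0" "z > 0"
  defines "\<psi> \<equiv> \<lambda>x z. real u / x ^ Suc u / (z - x) - 1 / x ^ u / (z - x) ^ 2"
  shows "inv_monomials3 (Suc (Suc u)) x y z =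
     1 / x ^ u / ((y - x) * (z - x)) + 1 / y ^ u / ((x - y) * (z - y)) + 1 / z ^ u / ((x - z) * (y - z))
     + (if x = y then \<psi> x z else 0) + (if x = z then \<psi> x y else 0) + (if y = z then \<psi> y x else 0)
     + (if x = y \<and> y = z then real (Suc u choose 2) / x ^ Suc (Suc u) else 0)"
proof -
  have sq: "(a - b) * (a - b) = (b - a) ^ 2" for a b :: real by (simp add: power2_eq_square algebra_simps)
  consider "x = y" "y = z" | "x = y" "y \<noteq> z" | "x = z" "y \<noteq> z" | "y = z" "x \<noteq> y" | "x \<noteq> y" "y \<noteq> z" "x \<noteq> z"
    by blast
  thus ?thesis
  proof cases
    case 1
    thus ?thesis using assms inv_monomials3_equal[of x u] by simp
  next
    case 2
    thus ?thesis using assms inv_monomials3_pair[of x z u] by (simp add: sq)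
  next
    case 3
    have "inv_monomials3 (Suc (Suc u)) z y z = inv_monomials3 (Suc (Suc u)) z z y"
      by (rule inv_monomials3_rotate[symmetric])
    thus ?thesis using 3 assms inv_monomials3_pair[of x y u] by (simp add: sq)
  next
    case 4
    have "inv_monomials3 (Suc (Suc u)) x z z = inv_monomials3 (Suc (Suc u)) z z x"
      by (rule inv_monomials3_rotate)
    thus ?thesis using 4 assms inv_monomials3_pair[of y x u] by (simp add: sq)
  next
    case 5
    thus ?thesis using assms inv_monomials3_distinct[of x y z u] by simp
  qed
qed

text \<open>For k \<ge> 1 the term m = l has denominator 0 and counts as 0, so this is the sum over
  all m different from l.\<close>

definition diff_sum :: "nat \<Rightarrow> nat \<Rightarrow> bool \<Rightarrow> nat \<Rightarrow> real" where
  "diff_sum k M b l = (\<Sum>m\<in>{1..M}. zsgn b ^ m / (real m - real l) ^ k)"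

section \<open>Splitting the triple product by coincidences of the summation indices\<close>

lemma esum_trunc_single: "esum_trunc [(s, b)] M = (\<Sum>n\<in>{1..M}. zsgn b ^ n / real n ^ s)"
  by (simp add: esum_trunc.simps(2))

lemma sum_prod3:
  fixes f g h :: "nat \<Rightarrow> real"
  shows "sum f A * sum g A * sum h A = (\<Sum>l\<in>A. \<Sum>m\<in>A. \<Sum>n\<in>A. f l * g m * h n)"
  unfolding sum_product[of f A g A] unfolding sum_distrib_right unfolding sum_distrib_left ..

text \<open>The first three sums come from the three partial fractions with distinct denominators,
  the next three from a coincidence of two indices, where the signs of the two factors multiply, and
  the last term from all three indices being equal.\<close>

lemma product_sum_decomposition:
  fixes u M :: nat and s1 s2 s3 :: bool
  defines "A \<equiv> diff_sum 1 M" and "B \<equiv> diff_sum 2 M"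
  shows "(\<Sum>(p, q, r)\<in>comps3 (Suc (Suc u)). esum_trunc [(p, s1)] M * esum_trunc [(q, s2)] M * esum_trunc [(r, s3)] M) =
     (\<Sum>l\<in>{1..M}. zsgn s1 ^ l / real l ^ u * (A s2 l * A s3 l))
   + (\<Sum>l\<in>{1..M}. zsgn s2 ^ l / real l ^ u * (A s1 l * A s3 l))
   + (\<Sum>l\<in>{1..M}. zsgn s3 ^ l / real l ^ u * (A s1 l * A s2 l))
   + (\<Sum>l\<in>{1..M}. zsgn (s1 \<noteq> s2) ^ l * (real u / real l ^ Suc u * A s3 l - 1 / real l ^ u * B s3 l))
   + (\<Sum>l\<in>{1..M}. zsgn (s1 \<noteq> s3) ^ l * (real u / real l ^ Suc u * A s2 l - 1 / real l ^ u * B s2 l))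
   + (\<Sum>l\<in>{1..M}. zsgn (s2 \<noteq> s3) ^ l * (real u / real l ^ Suc u * A s1 l - 1 / real l ^ u * B s1 l))
   + real (Suc u choose 2) * esum_trunc [(Suc (Suc u), (s1 \<noteq> s2) \<noteq> s3)] M"
proof -
  define I where "I = {1..M}"
  have [simp]: "finite I" by (simp add: I_def)
  have pos: "l > 0" if "l \<in> I" for l using that by (simp add: I_def)
  define a b c where "a = (\<lambda>n. zsgn s1 ^ n)" and "b = (\<lambda>n. zsgn s2 ^ n)" and "c = (\<lambda>n. zsgn s3 ^ n)"
  define \<psi> where "\<psi> l n = real u / real l ^ Suc u / (real n - real l) - 1 / real l ^ u / (real n - real l) ^ 2" for l n
  have \<psi>: "(\<Sum>n\<in>I. d * (zsgn s ^ n * \<psi> l n)) = d * (real u / real l ^ Suc u * A s l - 1 / real l ^ u * B s l)" for d s l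
  proof -
    have "(\<Sum>n\<in>I. zsgn s ^ n * \<psi> l n) = real u / real l ^ Suc u * A s l - 1 / real l ^ u * B s l"
      unfolding A_def B_def diff_sum_def \<psi>_def sum_distrib_left sum_subtractf[symmetric] I_def
      by (intro sum.cong refl) (simp add: field_simps)
    thus ?thesis by (simp flip: sum_distrib_left)
  qed
  have prod: "(\<Sum>m\<in>I. \<Sum>n\<in>I. k * (f m * g n)) = k * (sum f I * sum g I)" for k :: real and f g
    unfolding sum_product unfolding sum_distrib_left ..
  have A: "A s l = (\<Sum>m\<in>I. zsgn s ^ m / (real m - real l))" for s l
    by (simp add: A_def diff_sum_def I_def)
  have "(\<Sum>(p, q, r)\<in>comps3 (Suc (Suc u)). esum_trunc [(p, s1)] M * esum_trunc [(q, s2)] M * esum_trunc [(r, s3)] M)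
     = (\<Sum>(p, q, r)\<in>comps3 (Suc (Suc u)). \<Sum>l\<in>I. \<Sum>m\<in>I. \<Sum>n\<in>I. a l * b m * c n * (1 / (real l ^ p * real m ^ q * real n ^ r)))"
    unfolding esum_trunc_single sum_prod3 by (simp add: a_def b_def c_def I_def)
  also have "\<dots> = (\<Sum>l\<in>I. \<Sum>m\<in>I. \<Sum>n\<in>I. a l * b m * c n * inv_monomials3 (Suc (Suc u)) (real l) (real m) (real n))"
    unfolding inv_monomials3_def case_prod_unfold sum_distrib_left
    by (subst sum.swap, intro sum.cong refl, subst sum.swap, intro sum.cong refl, subst sum.swap) (rule refl)
  \<comment> \<open>The conditions are oriented so that each collapses the innermost sum over n. The
    condition l = m does not involve n and is collapsed after exchanging sums.\<close>
  also have "\<dots> = (\<Sum>l\<in>I. \<Sum>m\<in>I. \<Sum>n\<in>I.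
        a l / real l ^ u * ((b m / (real m - real l)) * (c n / (real n - real l)))
      + b m / real m ^ u * ((a l / (real l - real m)) * (c n / (real n - real m)))
      + c n / real n ^ u * ((a l / (real l - real n)) * (b m / (real m - real n)))
      + (if l = m then a l * b l * (c n * \<psi> l n) else 0)
      + (if n = l then a l * c l * (b m * \<psi> l m) else 0)
      + (if n = m then b m * c m * (a l * \<psi> m l) else 0)
      + (if n = m then if l = m then a l * b l * c l * (real (Suc u choose 2) / real l ^ Suc (Suc u)) else 0 else 0))"
    by (intro sum.cong refl, subst inv_monomials3_partial_fractions)
       (auto simp: pos \<psi>_def algebra_simps)
  also have "\<dots> = 
      (\<Sum>l\<in>I. \<Sum>m\<in>I. \<Sum>n\<in>I. a l / real l ^ u * ((b m / (real m - real l)) * (c n / (real n - real l))))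
      + (\<Sum>l\<in>I. \<Sum>m\<in>I. \<Sum>n\<in>I. b m / real m ^ u * ((a l / (real l - real m)) * (c n / (real n - real m))))
      + (\<Sum>l\<in>I. \<Sum>m\<in>I. \<Sum>n\<in>I. c n / real n ^ u * ((a l / (real l - real n)) * (b m / (real m - real n))))
      + (\<Sum>l\<in>I. \<Sum>n\<in>I. a l * b l * (c n * \<psi> l n))
      + (\<Sum>l\<in>I. \<Sum>m\<in>I. a l * c l * (b m * \<psi> l m))
      + (\<Sum>l\<in>I. \<Sum>m\<in>I. b m * c m * (a l * \<psi> m l))
      + (\<Sum>l\<in>I. a l * b l * c l * (real (Suc u choose 2) / real l ^ Suc (Suc u)))"
  proof -
    have "(\<Sum>l\<in>I. \<Sum>m\<in>I. \<Sum>n\<in>I. if l = m then a l * b l * (c n * \<psi> l n) else 0) = (\<Sum>l\<in>I. \<Sum>n\<in>I. a l * b l * (c n * \<psi> l n))"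
      by (subst sum.swap[of _ I I]) (simp add: sum.delta cong: sum.cong)
    thus ?thesis by (simp add: sum.distrib sum.delta sum.delta')
  qed
  also have "(\<Sum>l\<in>I. \<Sum>m\<in>I. \<Sum>n\<in>I. a l / real l ^ u * ((b m / (real m - real l)) * (c n / (real n - real l))))
      = (\<Sum>l\<in>I. a l / real l ^ u * (A s2 l * A s3 l))"
    unfolding prod A b_def c_def ..
  also have "(\<Sum>l\<in>I. \<Sum>m\<in>I. \<Sum>n\<in>I. b m / real m ^ u * ((a l / (real l - real m)) * (c n / (real n - real m))))
      = (\<Sum>l\<in>I. b l / real l ^ u * (A s1 l * A s3 l))"
    by (subst sum.swap) (simp only: prod A a_def c_def)
  also have "(\<Sum>l\<in>I. \<Sum>m\<in>I. \<Sum>n\<in>I. c n / real n ^ u * ((a l / (real l - real n)) * (b m / (real m - real n))))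
      = (\<Sum>n\<in>I. \<Sum>l\<in>I. \<Sum>m\<in>I. c n / real n ^ u * ((a l / (real l - real n)) * (b m / (real m - real n))))"
    by (subst (2) sum.swap, subst sum.swap, rule refl)
  also have "\<dots> = (\<Sum>l\<in>I. c l / real l ^ u * (A s1 l * A s2 l))"
    unfolding prod A a_def b_def ..
  also have "(\<Sum>l\<in>I. \<Sum>m\<in>I. b m * c m * (a l * \<psi> m l)) = (\<Sum>m\<in>I. \<Sum>l\<in>I. b m * c m * (a l * \<psi> m l))"
    by (rule sum.swap)
  also have "(\<Sum>l\<in>I. a l * b l * c l * (real (Suc u choose 2) / real l ^ Suc (Suc u))) =
      real (Suc u choose 2) * esum_trunc [(Suc (Suc u), (s1 \<noteq> s2) \<noteq> s3)] M"
    unfolding esum_trunc_single sum_distrib_left I_def zsgn_neq power_mult_distrib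
    by (intro sum.cong refl) (simp add: a_def b_def c_def)
  finally show ?thesis
    unfolding a_def b_def c_def \<psi> unfolding I_def zsgn_neq power_mult_distrib .
qed

lemma sum_around:
  fixes F :: "nat \<Rightarrow> real"
  assumes "l \<in> {1..M}"
  shows "sum F {1..M} = (\<Sum>k\<in>{1..l - 1}. F (l - k)) + F l + (\<Sum>k\<in>{1..M - l}. F (l + k))"
proof -
  have "{1..M} = {1..<l} \<union> {l} \<union> {l<..M}" using assms by auto
  moreover have "sum F ({1..<l} \<union> {l<..M}) = sum F {1..<l} + sum F {l<..M}"
    by (rule sum.union_disjoint) auto
  ultimately have "sum F {1..M} = sum F {1..<l} + F l + sum F {l<..M}" by simp
  also have "sum F {1..<l} = (\<Sum>k\<in>{1..l - 1}. F (l - k))"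
    by (rule sum.reindex_bij_witness[of _ "\<lambda>k. l - k" "\<lambda>k. l - k"]) auto
  also have "sum F {l<..M} = (\<Sum>k\<in>{1..M - l}. F (l + k))"
    using assms by (intro sum.reindex_bij_witness[of _ "\<lambda>k. l + k" "\<lambda>k. k - l"]) auto
  finally show ?thesis .
qed

text \<open>With m = l + j on the right and m = l - j on the left of l, signs of period 2 let zsgn
  b^l be factored out on both sides. The cut-off M - l on the right is the source of all later
  errors.\<close>

lemma diff_sum_eq:
  assumes "l \<in> {1..M}" "k \<ge> 1"
  shows "diff_sum k M b l = zsgn b ^ l * (esum_trunc [(k, b)] (M - l) + (- 1) ^ k * esum_trunc [(k, b)] (l - 1))"
proof -
  have 1: "zsgn b ^ (l - j) / (real (l - j) - real l) ^ k = zsgn b ^ l * ((- 1) ^ k * (zsgn b ^ j / real j ^ k))"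
    if "j \<in> {1..l - 1}" for j
  proof -
    have "zsgn b ^ l * zsgn b ^ j = zsgn b ^ (l - j) * (zsgn b ^ j * zsgn b ^ j)"
    proof -
      have "l + j = (l - j) + (j + j)" using that by auto
      thus ?thesis by (metis power_add)
    qed
    also have "zsgn b ^ j * zsgn b ^ j = 1"
      by (cases b) (auto simp flip: power_mult_distrib)
    finally have z: "zsgn b ^ (l - j) = zsgn b ^ l * zsgn b ^ j" by simp
    have "real (l - j) - real l = - 1 * real j" using that by (subst of_nat_diff) auto
    hence "(real (l - j) - real l) ^ k = (- 1) ^ k * real j ^ k" by (simp only: power_mult_distrib)
    moreover have "x / ((- 1) ^ k * y) = (- 1) ^ k * (x / y)" for x y :: real
      by (cases "even k") auto
    ultimately show ?thesis unfolding z by simp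
  qed
  have 0: "zsgn b ^ l / (real l - real l) ^ k = 0" using assms(2) by simp
  have 2: "zsgn b ^ (l + j) / (real (l + j) - real l) ^ k = zsgn b ^ l * (zsgn b ^ j / real j ^ k)" for j
    by (simp add: power_add)
  have "diff_sum k M b l = (\<Sum>j\<in>{1..l - 1}. zsgn b ^ l * ((- 1) ^ k * (zsgn b ^ j / real j ^ k)))
      + (\<Sum>j\<in>{1..M - l}. zsgn b ^ l * (zsgn b ^ j / real j ^ k))"
    by (simp only: diff_sum_def sum_around[OF assms(1)] sum.cong[OF refl 1] 0 2 add_0_right)
  thus ?thesis unfolding esum_trunc_single distrib_left sum_distrib_left by (simp add: add.commute)
qed

section \<open>The error made by changing the cut-off\<close>

lemma abs_esum_trunc_single_diff_le:
  assumes "m \<le> n" "k \<ge> 1"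
  shows "\<bar>esum_trunc [(k, b)] n - esum_trunc [(k, b)] m\<bar> \<le> harm n - harm m"
  using assms(1)
proof (induction n rule: dec_induct)
  case (step n)
  have "\<bar>zsgn b ^ Suc n / real (Suc n) ^ k\<bar> \<le> inverse (real (Suc n))"
    unfolding abs_divide abs_zsgn_power using assms(2) self_le_power[of "real (Suc n)" k]
    by (auto simp: inverse_eq_divide power_abs intro!: divide_left_mono)
  thus ?case using step.IH 
    unfolding esum_trunc_Suc harm_Suc esum_trunc.simps(1) mult_1_right by linarith
qed simp

lemma abs_esum_trunc_single_le: "k \<ge> 1 \<Longrightarrow> \<bar>esum_trunc [(k, b)] n\<bar> \<le> harm n"
  using abs_esum_trunc_single_diff_le[of 0 n k b] by (simp add: harm_expand)

lemma harm_diff_le: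
  assumes "l \<le> M"
  shows "harm M - harm (M - l) \<le> real l / (real M - real l + 1)"
proof -
  have "harm (m + l) - harm m \<le> real l / (real m + 1)" for m l
  proof (induction l)
    case (Suc l)
    have "inverse (real (Suc (m + l))) \<le> 1 / (real m + 1)"
      by (simp add: inverse_eq_divide frac_le)
    thus ?case using Suc by (simp add: harm_Suc add_divide_distrib)
  qed simp
  from this[of "M - l" l] show ?thesis using assms by (simp add: of_nat_diff)
qed

text \<open>By \<open>harm_diff_le\<close> the summand is at most 1/(l (M - l + 1)), which is (1/l +
  1/(M - l + 1))/(M + 1); each of the two resulting sums is \<open>harm M\<close>.\<close>

lemma sum_harm_diff_over_square:
  "(\<Sum>l\<in>{1..M}. (harm M - harm (M - l)) / real l ^ 2) \<le> 2 * harm M / (real M + 1)"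
proof -
  have "(\<Sum>l\<in>{1..M}. (harm M - harm (M - l)) / real l ^ 2)
      \<le> (\<Sum>l\<in>{1..M}. (1 / real l + 1 / (real M - real l + 1)) / (real M + 1))"
  proof (intro sum_mono)
    fix l assume l: "l \<in> {1..M}"
    have "(harm M - harm (M - l)) / real l ^ 2 \<le> (real l / (real M - real l + 1)) / real l ^ 2"
      using l by (intro divide_right_mono harm_diff_le) auto
    also have "\<dots> = (1 / real l + 1 / (real M - real l + 1)) / (real M + 1)"
    proof -
      have "real l > 0" "real M - real l + 1 > 0" using l by auto
      thus ?thesis by (simp add: divide_simps power2_eq_square)
    qed
    finally show "(harm M - harm (M - l)) / real l ^ 2 \<le> (1 / real l + 1 / (real M - real l + 1)) / (real M + 1)" .
  qed
  also have "\<dots> = ((\<Sum>l\<in>{1..M}. 1 / real l) + (\<Sum>l\<in>{1..M}. 1 / (real M - real l + 1))) / (real M + 1)"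
    by (simp add: sum.distrib sum_divide_distrib add_divide_distrib)
  also have "(\<Sum>l\<in>{1..M}. 1 / (real M - real l + 1)) = (\<Sum>l\<in>{1..M}. 1 / real l)"
    by (rule sum.reindex_bij_witness[of _ "\<lambda>l. M + 1 - l" "\<lambda>l. M + 1 - l"]) (auto simp: of_nat_diff)
  also have "(\<Sum>l\<in>{1..M}. 1 / real l) = harm M" by (simp add: harm_def inverse_eq_divide)
  finally show ?thesis by simp
qed

lemma poly_harm_over_linear_tendsto_0: "(\<lambda>M. poly P (harm M) / (real M + 1)) \<longlonglongrightarrow> 0"
proof -
  obtain C where C: "\<And>n. \<bar>poly P (harm n)\<bar> \<le> C * sqrt (real n + 1)"
    using poly_harm_le_sqrt by blast
  have "eventually (\<lambda>n. norm (poly P (harm n) / (real n + 1)) \<le> C * (1 / sqrt (real n + 1))) sequentially"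
  proof (intro always_eventually allI)
    fix n
    have "norm (poly P (harm n) / (real n + 1)) \<le> (C * sqrt (real n + 1)) / (real n + 1)"
      using C[of n] by (simp add: abs_divide divide_right_mono)
    also have "\<dots> = C * (1 / sqrt (real n + 1))"
      using sqrt_over_self[of "real n + 1"] by (simp flip: times_divide_eq_right)
    finally show "norm (poly P (harm n) / (real n + 1)) \<le> C * (1 / sqrt (real n + 1))" .
  qed
  moreover have "(\<lambda>n. C * (1 / sqrt (real n + 1))) \<longlonglongrightarrow> 0"
  proof -
    have "filterlim (\<lambda>n. sqrt (real n + 1)) at_top sequentially"
      by (rule filterlim_compose[OF sqrt_at_top])
         (rule filterlim_at_top_mono[OF filterlim_real_sequentially], simp)
    hence "(\<lambda>n. 1 / sqrt (real n + 1)) \<longlonglongrightarrow> 0"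
      by (intro tendsto_divide_0[OF tendsto_const] filterlim_at_top_imp_at_infinity)
    thus ?thesis by (rule tendsto_mult_right_zero)
  qed
  ultimately show ?thesis by (rule Lim_null_comparison)
qed

text \<open>Replacing a partial sum up to \<open>M - l\<close> by the one up to \<open>M\<close> costs at most
  \<open>harm M - harm (M - l) \<le> l / (M - l + 1)\<close>, whose weighted sum over \<open>l\<close> tends to 0.\<close>

lemma weighted_error_tendsto_0:
  assumes k: "k \<ge> 2" and \<rho>: "\<And>l. \<bar>\<rho> l\<bar> \<le> (1::real)"
    and c: "\<And>M l. l \<in> {1..M} \<Longrightarrow> \<bar>c M l\<bar> \<le> poly P (harm M) * (harm M - harm (M - l))"
    and P: "\<And>M. poly P (harm M) \<ge> 0"
  shows "(\<lambda>M. \<Sum>l\<in>{1..M}. \<rho> l / real l ^ k * c M l) \<longlonglongrightarrow> 0"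
proof -
  have "eventually (\<lambda>M. norm (\<Sum>l\<in>{1..M}. \<rho> l / real l ^ k * c M l) \<le> poly (P * [:0, 2:]) (harm M) / (real M + 1)) sequentially"
  proof (intro always_eventually allI)
    fix M
    have "norm (\<Sum>l\<in>{1..M}. \<rho> l / real l ^ k * c M l) \<le> (\<Sum>l\<in>{1..M}. poly P (harm M) * ((harm M - harm (M - l)) / real l ^ 2))"
    proof (rule sum_norm_le)
      fix l assume l: "l \<in> {1..M}"
      have "\<bar>\<rho> l\<bar> / real l ^ k \<le> 1 / real l ^ 2"
        using \<rho> l k by (intro frac_le power_increasing) auto
      hence "(\<bar>\<rho> l\<bar> / real l ^ k) * \<bar>c M l\<bar> \<le> (1 / real l ^ 2) * (poly P (harm M) * (harm M - harm (M - l)))"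
        using c[OF l] by (intro mult_mono) auto
      thus "norm (\<rho> l / real l ^ k * c M l) \<le> poly P (harm M) * ((harm M - harm (M - l)) / real l ^ 2)"
        by (simp add: abs_mult abs_divide power_abs)
    qed
    also have "\<dots> = poly P (harm M) * (\<Sum>l\<in>{1..M}. (harm M - harm (M - l)) / real l ^ 2)"
      by (rule sum_distrib_left[symmetric])
    also have "\<dots> \<le> poly P (harm M) * (2 * harm M / (real M + 1))"
      by (intro mult_left_mono sum_harm_diff_over_square P)
    finally show "norm (\<Sum>l\<in>{1..M}. \<rho> l / real l ^ k * c M l) \<le> poly (P * [:0, 2:]) (harm M) / (real M + 1)"
      by (simp add: mult_ac)
  qed
  thus ?thesis by (rule Lim_null_comparison) (rule poly_harm_over_linear_tendsto_0)
qed

section \<open>Tail sums and their expansion into nested sums\<close>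

definition tail_sum :: "nat \<Rightarrow> bool \<Rightarrow> nat \<Rightarrow> real" where
  "tail_sum M b l = esum_trunc [(1, b)] M - esum_trunc [(1, b)] (l - 1)"

lemma tail_sum_Suc:
  "l \<le> M \<Longrightarrow> tail_sum (Suc M) b l = tail_sum M b l + zsgn b ^ Suc M / real (Suc M)"
  "tail_sum (Suc M) b (Suc M) = zsgn b ^ Suc M / real (Suc M)"
  by (auto simp: tail_sum_def esum_trunc_Suc)

text \<open>\<open>tail_sum M j l\<close> runs over l \<le> n \<le> M with n = l included; n > l
  gives the nested sum, n = l the diagonal one.\<close>

lemma sum_tail_sum:
  "(\<Sum>l\<in>{1..M}. zsgn \<pi> ^ l / real l ^ u * tail_sum M j l) =
     esum_trunc [(1, j), (u, \<pi>)] M + esum_trunc [(Suc u, \<pi> \<noteq> j)] M"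
proof (induction M)
  case (Suc M)
  define \<alpha> where "\<alpha> = zsgn j ^ Suc M / real (Suc M)"
  have "(\<Sum>l\<in>{1..Suc M}. zsgn \<pi> ^ l / real l ^ u * tail_sum (Suc M) j l) =
      (\<Sum>l\<in>{1..M}. zsgn \<pi> ^ l / real l ^ u * (tail_sum M j l + \<alpha>)) + zsgn \<pi> ^ Suc M / real (Suc M) ^ u * \<alpha>"
    by (subst sum.nat_ivl_Suc', simp, subst add.commute, intro arg_cong2[of _ _ _ _ "(+)"] sum.cong refl)
       (simp_all add: tail_sum_Suc \<alpha>_def)
  also have "\<dots> = (\<Sum>l\<in>{1..M}. zsgn \<pi> ^ l / real l ^ u * tail_sum M j l) + esum_trunc [(u, \<pi>)] M * \<alpha>
      + zsgn \<pi> ^ Suc M / real (Suc M) ^ u * \<alpha>"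
    by (simp add: distrib_left sum.distrib esum_trunc_single sum_distrib_right del: power_Suc)
  also have "zsgn \<pi> ^ Suc M / real (Suc M) ^ u * \<alpha> = zsgn (\<pi> \<noteq> j) ^ Suc M / real (Suc M) ^ Suc u"
    unfolding zsgn_neq power_mult_distrib by (simp add: \<alpha>_def mult_ac)
  finally show ?case unfolding Suc.IH esum_trunc_Suc by (simp add: \<alpha>_def)
qed simp

text \<open>The six terms are the six ways to order two indices n, n' that are both at least l: two
  strict orders above l, n = n' above l, exactly one of them equal to l (twice), and both equal to
  l.\<close>

lemma sum_tail_sum_product:
  "(\<Sum>l\<in>{1..M}. zsgn \<pi> ^ l / real l ^ u * (tail_sum M j l * tail_sum M k l)) =
     esum_trunc [(1, j), (1, k), (u, \<pi>)] M + esum_trunc [(1, k), (1, j), (u, \<pi>)] M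
     + esum_trunc [(2, j \<noteq> k), (u, \<pi>)] M
     + esum_trunc [(1, j), (Suc u, \<pi> \<noteq> k)] M + esum_trunc [(1, k), (Suc u, \<pi> \<noteq> j)] M
     + esum_trunc [(Suc (Suc u), (\<pi> \<noteq> j) \<noteq> k)] M"
proof (induction M)
  case (Suc M)
  define \<alpha> \<beta> where "\<alpha> = zsgn j ^ Suc M / real (Suc M)" and "\<beta> = zsgn k ^ Suc M / real (Suc M)"
  let ?w = "\<lambda>l. zsgn \<pi> ^ l / real l ^ u"
  have "(\<Sum>l\<in>{1..Suc M}. ?w l * (tail_sum (Suc M) j l * tail_sum (Suc M) k l)) =
      (\<Sum>l\<in>{1..M}. ?w l * ((tail_sum M j l + \<alpha>) * (tail_sum M k l + \<beta>))) + ?w (Suc M) * (\<alpha> * \<beta>)"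
    by (subst sum.nat_ivl_Suc', simp, subst add.commute, intro arg_cong2[of _ _ _ _ "(+)"] sum.cong refl)
       (simp_all add: tail_sum_Suc \<alpha>_def \<beta>_def)
  also have "(\<Sum>l\<in>{1..M}. ?w l * ((tail_sum M j l + \<alpha>) * (tail_sum M k l + \<beta>))) =
      (\<Sum>l\<in>{1..M}. ?w l * (tail_sum M j l * tail_sum M k l)) + \<alpha> * (\<Sum>l\<in>{1..M}. ?w l * tail_sum M k l)
      + \<beta> * (\<Sum>l\<in>{1..M}. ?w l * tail_sum M j l) + \<alpha> * \<beta> * esum_trunc [(u, \<pi>)] M"
    unfolding esum_trunc_single sum_distrib_left sum.distrib[symmetric]
    by (intro sum.cong refl) (simp add: algebra_simps)
  also have "?w (Suc M) * (\<alpha> * \<beta>) = zsgn ((\<pi> \<noteq> j) \<noteq> k) ^ Suc M / real (Suc M) ^ Suc (Suc u)"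
    unfolding zsgn_neq power_mult_distrib by (simp add: \<alpha>_def \<beta>_def mult_ac)
  also have "\<alpha> * \<beta> = zsgn (j \<noteq> k) ^ Suc M / real (Suc M) ^ 2"
    unfolding zsgn_neq power_mult_distrib by (simp add: \<alpha>_def \<beta>_def power2_eq_square mult_ac)
  finally show ?case unfolding Suc.IH sum_tail_sum esum_trunc_Suc
    by (simp add: \<alpha>_def \<beta>_def algebra_simps del: power_Suc of_nat_Suc)
qed simp

lemma stuffle_depth1:
  "esum_trunc [(s, b)] M * esum_trunc [(t, c)] M =
     esum_trunc [(s, b), (t, c)] M + esum_trunc [(t, c), (s, b)] M + esum_trunc [(s + t, b \<noteq> c)] M"
proof (induction M)
  case (Suc M)
  define \<alpha> \<beta> where "\<alpha> = zsgn b ^ Suc M / real (Suc M) ^ s" and "\<beta> = zsgn c ^ Suc M / real (Suc M) ^ t"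
  have \<alpha>\<beta>: "zsgn (b \<noteq> c) ^ Suc M / real (Suc M) ^ (s + t) = \<alpha> * \<beta>"
    unfolding zsgn_neq power_mult_distrib by (simp add: \<alpha>_def \<beta>_def power_add mult_ac)
  show ?case
    unfolding esum_trunc_Suc \<alpha>\<beta> \<alpha>_def[symmetric] \<beta>_def[symmetric] using Suc.IH by (simp add: algebra_simps)
qed simp

text \<open>The factor \<open>zsgn b ^ l\<close> strips the sign in \<open>diff_sum_eq\<close> and
  leaves the partial sum up to M - l minus the one up to l - 1; raising the first cut-off to M turns
  this into \<open>tail_sum\<close>. For exponent 2, treated next, the two partial sums are
  added.\<close>

lemma diff_sum_1_error:
  assumes "l \<in> {1..M}"
  shows "\<bar>zsgn b ^ l * diff_sum 1 M b l - tail_sum M b l\<bar> \<le> harm M - harm (M - l)"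
    and "\<bar>zsgn b ^ l * diff_sum 1 M b l\<bar> \<le> 2 * harm M" and "\<bar>tail_sum M b l\<bar> \<le> 2 * harm M"
proof -
  have "zsgn b ^ l * zsgn b ^ l = 1" by (cases b) (auto simp flip: power_mult_distrib)
  hence eq: "zsgn b ^ l * diff_sum 1 M b l = esum_trunc [(1, b)] (M - l) - esum_trunc [(1, b)] (l - 1)"
    using diff_sum_eq[OF assms, of 1 b] by (simp flip: mult.assoc)
  show "\<bar>zsgn b ^ l * diff_sum 1 M b l - tail_sum M b l\<bar> \<le> harm M - harm (M - l)"
    unfolding eq tail_sum_def using abs_esum_trunc_single_diff_le[of "M - l" M 1 b]
    by (simp add: abs_minus_commute)
  have h: "\<bar>esum_trunc [(1, b)] n\<bar> \<le> harm M" if "n \<le> M" for n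
    using abs_esum_trunc_single_le[of 1 b n] harm_mono[OF that, where 'a = real] by simp
  show "\<bar>zsgn b ^ l * diff_sum 1 M b l\<bar> \<le> 2 * harm M"
    unfolding eq using h[of "M - l"] h[of "l - 1"] assms by (simp add: abs_le_iff) linarith
  show "\<bar>tail_sum M b l\<bar> \<le> 2 * harm M"
    unfolding tail_sum_def using h[of M] h[of "l - 1"] assms by (simp add: abs_le_iff) linarith
qed


lemma diff_sum_2_error:
  assumes "l \<in> {1..M}"
  shows "\<bar>zsgn b ^ l * diff_sum 2 M b l - (esum_trunc [(2, b)] M + esum_trunc [(2, b)] (l - 1))\<bar> \<le> harm M - harm (M - l)"
proof -
  have "zsgn b ^ l * zsgn b ^ l = 1" by (cases b) (auto simp flip: power_mult_distrib)
  hence eq: "zsgn b ^ l * diff_sum 2 M b l = esum_trunc [(2, b)] (M - l) + esum_trunc [(2, b)] (l - 1)"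
    using diff_sum_eq[OF assms, of 2 b] by (simp flip: mult.assoc)
  show ?thesis
    unfolding eq using abs_esum_trunc_single_diff_le[of "M - l" M 2 b] by (simp add: abs_minus_commute)
qed

text \<open>The share of the factor with sign i: the partial fraction in its own index together with
  the coincidence of the other two indices. The first six terms are those of
  \<open>sum_tail_sum_product\<close>, the bracket with factor u is \<open>sum_tail_sum\<close>, and
  the subtracted terms come from \<open>diff_sum\<close> with exponent 2. The functional
  \<open>Z\<close> is a parameter so that one expression serves both truncated sums and regularized
  polynomials.\<close>

definition stuffle_term ::
  "((nat \<times> bool) list \<Rightarrow> 'a::comm_ring_1) \<Rightarrow> nat \<Rightarrow> bool \<Rightarrow> bool \<Rightarrow> bool \<Rightarrow> bool \<Rightarrow> 'a" where
  "stuffle_term Z u \<pi> i j k =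
     Z [(1, j), (1, k), (u, \<pi>)] + Z [(1, k), (1, j), (u, \<pi>)] + Z [(2, j \<noteq> k), (u, \<pi>)]
     + Z [(1, j), (Suc u, \<pi> \<noteq> k)] + Z [(1, k), (Suc u, \<pi> \<noteq> j)] + Z [(Suc (Suc u), i)]
     + of_nat u * (Z [(1, i), (Suc u, \<pi>)] + Z [(Suc (Suc u), \<pi> \<noteq> i)])
     - 2 * Z [(u, \<pi>), (2, i)] - Z [(2, i), (u, \<pi>)] - Z [(Suc (Suc u), \<pi> \<noteq> i)]"

lemma stuffle_term_limit:
  assumes u: "u \<ge> 2" and \<pi>: "\<pi> \<longleftrightarrow> (i \<noteq> j) \<noteq> k"
  shows "(\<lambda>M. (\<Sum>l\<in>{1..M}. zsgn i ^ l / real l ^ u * (diff_sum 1 M j l * diff_sum 1 M k l))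
     + (\<Sum>l\<in>{1..M}. zsgn (j \<noteq> k) ^ l * (real u / real l ^ Suc u * diff_sum 1 M i l - 1 / real l ^ u * diff_sum 2 M i l))
     - stuffle_term (\<lambda>idx. esum_trunc idx M) u \<pi> i j k) \<longlonglongrightarrow> 0"
proof -
  define A where "A M b l = zsgn b ^ l * diff_sum 1 M b l" for M b l
  define B where "B M b l = zsgn b ^ l * diff_sum 2 M b l" for M b l
  define G where "G M b l = esum_trunc [(2, b)] M + esum_trunc [(2, b)] (l - 1)" for M b l
  define w where "w n l = zsgn \<pi> ^ l / real l ^ n" for n l
  have z2: "zsgn b ^ l * zsgn b ^ l = 1" for b l by (cases b) (auto simp flip: power_mult_distrib)
  have z\<pi>: "zsgn \<pi> ^ l = zsgn i ^ l * zsgn j ^ l * zsgn k ^ l" for l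
    unfolding \<pi> zsgn_neq power_mult_distrib ..
  \<comment> \<open>Every \<open>diff_sum\<close> brings its own sign to the power l. Collecting
    these turns the sign in front into the common sign \<open>\<pi>\<close>, because squares of
    signs are 1.\<close>
  have e1: "zsgn i ^ l / real l ^ u * (diff_sum 1 M j l * diff_sum 1 M k l) = w u l * (A M j l * A M k l)" for M l
  proof -
    have "w u l * (A M j l * A M k l) =
       zsgn i ^ l / real l ^ u * (diff_sum 1 M j l * diff_sum 1 M k l) * (zsgn j ^ l * zsgn j ^ l) * (zsgn k ^ l * zsgn k ^ l)"
      by (simp add: w_def A_def z\<pi> mult_ac)
    thus ?thesis by (simp add: z2)
  qed
  have e2: "zsgn (j \<noteq> k) ^ l * (real u / real l ^ Suc u * diff_sum 1 M i l - 1 / real l ^ u * diff_sum 2 M i l) =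
      real u * (w (Suc u) l * A M i l) - w u l * B M i l" for M l
  proof -
    have "real u * (w (Suc u) l * A M i l) - w u l * B M i l =
      (zsgn i ^ l * zsgn i ^ l) * (zsgn j ^ l * zsgn k ^ l * (real u / real l ^ Suc u * diff_sum 1 M i l - 1 / real l ^ u * diff_sum 2 M i l))"
      by (simp add: w_def A_def B_def z\<pi> right_diff_distrib mult_ac)
    thus ?thesis unfolding z2 zsgn_neq power_mult_distrib by simp
  qed
  have i: "((\<pi> \<noteq> j) \<noteq> k) = i" using \<pi> by auto
  have st: "stuffle_term (\<lambda>idx. esum_trunc idx M) u \<pi> i j k =
      (\<Sum>l\<in>{1..M}. w u l * (tail_sum M j l * tail_sum M k l)) + real u * (\<Sum>l\<in>{1..M}. w (Suc u) l * tail_sum M i l)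
      - (\<Sum>l\<in>{1..M}. w u l * G M i l)" for M
  proof -
    have "(\<Sum>l\<in>{1..M}. w u l * G M i l) = esum_trunc [(u, \<pi>)] M * esum_trunc [(2, i)] M + esum_trunc [(u, \<pi>), (2, i)] M"
      unfolding w_def G_def distrib_left sum.distrib sum_distrib_right[symmetric] esum_trunc_single[symmetric]
      by (simp add: esum_trunc.simps(2))
    also have "\<dots> = 2 * esum_trunc [(u, \<pi>), (2, i)] M + esum_trunc [(2, i), (u, \<pi>)] M + esum_trunc [(Suc (Suc u), \<pi> \<noteq> i)] M"
      unfolding stuffle_depth1[of u \<pi> M 2 i] by (simp add: numeral_2_eq_2)
    finally have g: "(\<Sum>l\<in>{1..M}. w u l * G M i l) = \<dots>" .
    show ?thesis unfolding g unfolding w_def sum_tail_sum sum_tail_sum_product i stuffle_term_def by simp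
  qed
  have h0: "harm M \<ge> (0::real)" for M by (rule harm_nonneg)
  have hm: "harm (M - l) \<le> (harm M :: real)" for M l by (rule harm_mono) simp
  have w1: "\<bar>zsgn \<pi> ^ l\<bar> \<le> 1" for l by simp
  have "(\<lambda>M. (\<Sum>l\<in>{1..M}. w u l * (A M j l * A M k l - tail_sum M j l * tail_sum M k l))) \<longlonglongrightarrow> 0"
    unfolding w_def
  \<comment> \<open>A difference of products is split into two terms, each a difference times a
    factor of size at most 2 \<open>harm M\<close>; this accounts for the 4.\<close>
  proof (rule weighted_error_tendsto_0[OF u w1, where P = "[:0, 4:]"])
    fix M l :: nat assume l: "l \<in> {1..M}"
    have "A M j l * A M k l - tail_sum M j l * tail_sum M k l =
        (A M j l - tail_sum M j l) * A M k l + tail_sum M j l * (A M k l - tail_sum M k l)"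
      by (simp add: algebra_simps)
    also have "\<bar>\<dots>\<bar> \<le> (harm M - harm (M - l)) * (2 * harm M) + (2 * harm M) * (harm M - harm (M - l))"
      unfolding A_def using diff_sum_1_error[OF l] hm[of M l] h0[of M]
      by (intro order.trans[OF abs_triangle_ineq] add_mono) (auto simp: abs_mult intro!: mult_mono)
    finally show "\<bar>A M j l * A M k l - tail_sum M j l * tail_sum M k l\<bar> \<le> poly [:0, 4:] (harm M) * (harm M - harm (M - l))"
      by (simp add: algebra_simps)
  qed (use h0 in auto)
  moreover have "(\<lambda>M. real u * (\<Sum>l\<in>{1..M}. w (Suc u) l * (A M i l - tail_sum M i l))) \<longlonglongrightarrow> real u * 0"
    unfolding w_def A_def
    by (intro tendsto_mult tendsto_const weighted_error_tendsto_0[where P = "[:1:]"])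
       (use diff_sum_1_error(1) u in auto)
  moreover have "(\<lambda>M. (\<Sum>l\<in>{1..M}. w u l * (B M i l - G M i l))) \<longlonglongrightarrow> 0"
    unfolding w_def B_def G_def
    by (rule weighted_error_tendsto_0[where P = "[:1:]"]) (use diff_sum_2_error u in auto)
  ultimately have "(\<lambda>M. (\<Sum>l\<in>{1..M}. w u l * (A M j l * A M k l - tail_sum M j l * tail_sum M k l))
      + real u * (\<Sum>l\<in>{1..M}. w (Suc u) l * (A M i l - tail_sum M i l))
      - (\<Sum>l\<in>{1..M}. w u l * (B M i l - G M i l))) \<longlonglongrightarrow> 0 + real u * 0 - 0"
    by (intro tendsto_diff tendsto_add)
  thus ?thesis
    unfolding e1 e2 st unfolding right_diff_distrib sum_subtractf sum_distrib_left[symmetric]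
    by (simp add: algebra_simps)
qed

lemma asymp_poly_stuffle_term:
  assumes "u \<ge> 1"
  shows "asymp_poly sequentially ln_gamma (\<lambda>M. stuffle_term (\<lambda>idx. esum_trunc idx M) u \<pi> i j k)
     (stuffle_term zeta_st u \<pi> i j k)"
  unfolding stuffle_term_def
  by (intro asymp_poly_add asymp_poly_diff asymp_poly_mult asymp_poly_of_nat asymp_poly_numeral asymp_poly_esum_trunc)
     (use assms in auto)

text \<open>The truncated product and its stuffle evaluation differ by a quantity known only to be
  o(1). That is enough here: the rapid decay was needed to expand each side by itself, and
  uniqueness of the polynomial needs no rate.\<close>

theorem stuffle_product3_regularized:
  assumes u: "u \<ge> 2" and \<pi>: "\<pi> \<longleftrightarrow> (s1 \<noteq> s2) \<noteq> s3"
  shows "(\<Sum>(p, q, r)\<in>comps3 (Suc (Suc u)). zeta_st [(p, s1)] * zeta_st [(q, s2)] * zeta_st [(r, s3)]) =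
     stuffle_term zeta_st u \<pi> s1 s2 s3 + stuffle_term zeta_st u \<pi> s2 s1 s3 + stuffle_term zeta_st u \<pi> s3 s1 s2
     + of_nat (Suc u choose 2) * zeta_st [(Suc (Suc u), \<pi>)]" (is "?L = ?R")
proof -
  define S where "S M = (\<Sum>(p, q, r)\<in>comps3 (Suc (Suc u)).
      esum_trunc [(p, s1)] M * esum_trunc [(q, s2)] M * esum_trunc [(r, s3)] M)" for M
  define R where "R M = stuffle_term (\<lambda>idx. esum_trunc idx M) u \<pi> s1 s2 s3
     + stuffle_term (\<lambda>idx. esum_trunc idx M) u \<pi> s2 s1 s3 + stuffle_term (\<lambda>idx. esum_trunc idx M) u \<pi> s3 s1 s2
     + of_nat (Suc u choose 2) * esum_trunc [(Suc (Suc u), \<pi>)] M" for M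
  have \<pi>': "\<pi> \<longleftrightarrow> (s2 \<noteq> s1) \<noteq> s3" "\<pi> \<longleftrightarrow> (s3 \<noteq> s1) \<noteq> s2" using \<pi> by auto
  have "asymp_poly sequentially ln_gamma S ?L"
    unfolding S_def case_prod_unfold
    by (intro asymp_poly_sum asymp_poly_mult asymp_poly_esum_trunc) (use comps3_ge_1 in auto)
  hence L: "(\<lambda>M. S M - poly ?L (ln_gamma M)) \<longlonglongrightarrow> 0" by (rule asymp_polyD)
  have "asymp_poly sequentially ln_gamma R ?R"
    unfolding R_def
    by (intro asymp_poly_add asymp_poly_mult asymp_poly_of_nat asymp_poly_stuffle_term asymp_poly_esum_trunc)
       (use u in auto)
  hence R: "(\<lambda>M. R M - poly ?R (ln_gamma M)) \<longlonglongrightarrow> 0" by (rule asymp_polyD)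
  have "(\<lambda>M. S M - R M) \<longlonglongrightarrow> 0"
    using tendsto_add[OF tendsto_add[OF stuffle_term_limit[OF u \<pi>] stuffle_term_limit[OF u \<pi>'(1)]] stuffle_term_limit[OF u \<pi>'(2)]]
    unfolding S_def R_def product_sum_decomposition \<pi>[symmetric] by (simp add: algebra_simps)
  from tendsto_add[OF this R] have "(\<lambda>M. S M - poly ?R (ln_gamma M)) \<longlonglongrightarrow> 0"
    by (simp only: diff_add_cancel add_diff_eq add_0_left)
  with L show ?thesis
    by (rule poly_asymptotics_unique[OF filterlim_ln_plus_euler_mascheroni sequentially_bot])
qed

section \<open>The combined identity and its four sign patterns\<close>

theorem weighted_sum_formula:
  assumes "u \<ge> 2" "\<pi> \<longleftrightarrow> (s1 \<noteq> s2) \<noteq> s3"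
  shows "weighted_zeta_sh (Suc (Suc u)) s1 s2 s3 + weighted_zeta_sh (Suc (Suc u)) s1 s3 s2
     + weighted_zeta_sh (Suc (Suc u)) s2 s1 s3 + weighted_zeta_sh (Suc (Suc u)) s2 s3 s1
     + weighted_zeta_sh (Suc (Suc u)) s3 s1 s2 + weighted_zeta_sh (Suc (Suc u)) s3 s2 s1 =
     stuffle_term zeta_st u \<pi> s1 s2 s3 + stuffle_term zeta_st u \<pi> s2 s1 s3 + stuffle_term zeta_st u \<pi> s3 s1 s2
     + of_nat (Suc u choose 2) * zeta_st [(Suc (Suc u), \<pi>)]"
  unfolding shuffle_product3_regularized[symmetric] by (rule stuffle_product3_regularized[OF assms])

lemma weighted_zeta_sh_True:
  "weighted_zeta_sh w True s2 s3 = (\<Sum>(a, b, c)\<in>comps3 w. smult (3 ^ (a - 1) * 2 ^ (b - 1))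
     (zc [(a, True), (b, \<not> s2), (c, s2 \<noteq> s3)]))"
  unfolding weighted_zeta_sh_def
  by (intro sum.cong refl) (auto simp: comps3_def zeta_sh_convergent)

theorem theorem6p1:
  fixes w u v :: nat
  assumes "w \<ge> 4" and "u = w - 2" and "v = w - 1"
  shows
  "(2 * (\<Sum>(a, b, c)\<in>comps3 w. smult (3 ^ (a - 1) * 2 ^ (b - 1))
          (zeta_sh [(a, False), (b, False), (c, False)]))
   = smult (real (v choose 2) / 3 + real u) (zc [(w, False)])
     + 2 * zeta_st [(1, False), (1, False), (u, False)]
     - 2 * zc [(u, False), (2, False)]
     + smult (real w) (zeta_st [(1, False), (v, False)]))
  \<and>
  (2 * (\<Sum>(a, b, c)\<in>comps3 w. smult (3 ^ (a - 1) * 2 ^ (b - 1))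
          (zeta_sh [(a, False), (b, True), (c, False)]
           + zc [(a, True), (b, False), (c, True)]
           + zc [(a, True), (b, True), (c, True)]))
   = 2 * zc [(1, True), (1, False), (u, False)]
     + 2 * zeta_st [(1, False), (1, True), (u, False)]
     + 2 * zc [(1, True), (1, True), (u, False)]
     + smult (real (v choose 2)) (zc [(w, False)])
     + 2 * zc [(1, True), (v, False)]
     + 2 * zeta_st [(1, False), (v, True)]
     + 2 * zc [(1, True), (v, True)]
     - 2 * zc [(u, False), (2, False)]
     - 4 * zc [(u, False), (2, True)]
     + smult (real u) (2 * zc [(1, True), (v, False)] + 2 * zc [(w, True)]
                       + zc [(w, False)] + zeta_st [(1, False), (v, False)]))
  \<and>
  (2 * (\<Sum>(a, b, c)\<in>comps3 w. smult (3 ^ (a - 1) * 2 ^ (b - 1))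
          (zeta_sh [(a, False), (b, True), (c, True)]
           + zeta_sh [(a, False), (b, False), (c, True)]
           + zc [(a, True), (b, True), (c, False)]))
   = 2 * zeta_st [(1, False), (1, False), (u, True)]
     + 2 * zeta_st [(1, False), (1, True), (u, True)]
     + 2 * zc [(1, True), (1, False), (u, True)]
     + 2 * zeta_st [(1, False), (v, True)]
     + 2 * zc [(1, True), (v, True)]
     + 2 * zeta_st [(1, False), (v, False)]
     + zc [(2, True), (u, True)]
     - zc [(2, False), (u, True)]
     - 4 * zc [(u, True), (2, False)]
     - 2 * zc [(u, True), (2, True)]
     + smult (real u) (2 * zeta_st [(1, False), (v, True)] + zc [(1, True), (v, True)]
                       + zc [(w, False)] + 2 * zc [(w, True)])
     + smult (real (v choose 2)) (zc [(w, True)])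
     + zc [(w, False)] - zc [(w, True)])
  \<and>
  (2 * (\<Sum>(a, b, c)\<in>comps3 w. smult (3 ^ (a - 1) * 2 ^ (b - 1))
          (zc [(a, True), (b, False), (c, False)]))
   = 2 * zc [(1, True), (1, True), (u, True)]
     + smult (real u) (zc [(1, True), (v, True)])
     + 2 * zc [(1, True), (v, False)]
     + zc [(2, False), (u, True)]
     - 2 * zc [(u, True), (2, True)]
     - zc [(2, True), (u, True)]
     + smult (real (v choose 2) / 3 + 1) (zc [(w, True)])
     + smult (real w - 3) (zc [(w, False)]))"
proof -
  have u: "u \<ge> 2" "u \<noteq> Suc 0" and v: "v = Suc u" and w: "w = Suc (Suc u)" using assms by auto
  have smult_of_nat: "of_nat n * p = smult (of_nat n) p" for n and p :: "real poly"
    by (simp add: of_nat_poly)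
  have smult_numeral: "numeral n * p = smult (numeral n) p" for n and p :: "real poly"
    by (simp add: numeral_poly)
  \<comment> \<open>For three equal signs all six orderings give the same weighted sum. The factor
    6, against the 2 in the claim, is what leaves one third of the binomial coefficient.\<close>
  have m1: "6 * weighted_zeta_sh w False False False = 3 * stuffle_term zeta_st u False False False False
      + of_nat (v choose 2) * zeta_st [(w, False)]"
    using weighted_sum_formula[OF u(1), of False False False False] by (simp add: v w)
  have m4: "6 * weighted_zeta_sh w True True True = 3 * stuffle_term zeta_st u True True True True
      + of_nat (v choose 2) * zeta_st [(w, True)]"
    using weighted_sum_formula[OF u(1), of True True True True] by (simp add: v w)
  \<comment> \<open>With two equal signs the six orderings coincide in pairs, so three different
    words remain, each counted twice; likewise in \<open>m3\<close>.\<close>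
  have m2: "2 * (weighted_zeta_sh w False True True + weighted_zeta_sh w True True False + weighted_zeta_sh w True False True)
      = stuffle_term zeta_st u False True True False + stuffle_term zeta_st u False True True False
      + stuffle_term zeta_st u False False True True + of_nat (v choose 2) * zeta_st [(w, False)]"
    using weighted_sum_formula[OF u(1), of False True True False] by (simp add: v w algebra_simps)
  have m3: "2 * (weighted_zeta_sh w False True False + weighted_zeta_sh w False False True + weighted_zeta_sh w True False False)
      = stuffle_term zeta_st u True False False True + stuffle_term zeta_st u True False False True
      + stuffle_term zeta_st u True True False False + of_nat (v choose 2) * zeta_st [(w, True)]"
    using weighted_sum_formula[OF u(1), of True False False True] by (simp add: v w algebra_simps)
  \<comment> \<open>These indices converge because u \<ge> 2 or because they begin with a barred 1;
    the regularized values that remain all begin with an unbarred 1.\<close>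
  have z: "zeta_st [(u, b), (2, c)] = zc [(u, b), (2, c)]" "zeta_st [(2, b), (u, c)] = zc [(2, b), (u, c)]"
    "zeta_st [(w, b)] = zc [(w, b)]" "zeta_st [(1, True), (v, b)] = zc [(1, True), (v, b)]"
    "zeta_st [(1, True), (1, b), (u, c)] = zc [(1, True), (1, b), (u, c)]" for b c
    using u by (auto simp: v w esum_trunc_convergent(2))
  note expand = stuffle_term_def[of zeta_st u, folded w, folded v]
  note lin = expand z[unfolded One_nat_def] smult_of_nat smult_numeral
  show ?thesis
  proof (intro conjI, goal_cases)
    case 1
    have "(\<Sum>(a, b, c)\<in>comps3 w. smult (3 ^ (a - 1) * 2 ^ (b - 1)) (zeta_sh [(a, False), (b, False), (c, False)])) =
        weighted_zeta_sh w False False False"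
      by (simp add: weighted_zeta_sh_def)
    \<comment> \<open>The identity holds for six times the weighted sum and is wanted for twice it;
      the division by 3 is carried out on real coefficients.\<close>
    moreover have "coeff (6 * weighted_zeta_sh w False False False) n =
        coeff (3 * stuffle_term zeta_st u False False False False + of_nat (v choose 2) * zeta_st [(w, False)]) n" for n
      by (simp only: m1)
    ultimately show ?case
      by (intro poly_eqI) (simp add: lin, simp add: w field_simps)
  next
    case 2
    have "(\<Sum>(a, b, c)\<in>comps3 w. smult (3 ^ (a - 1) * 2 ^ (b - 1))
          (zeta_sh [(a, False), (b, True), (c, False)] + zc [(a, True), (b, False), (c, True)]
           + zc [(a, True), (b, True), (c, True)])) =
        weighted_zeta_sh w False True True + weighted_zeta_sh w True True False + weighted_zeta_sh w True False True"
      unfolding weighted_zeta_sh_def[of w False] weighted_zeta_sh_True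
      by (simp add: smult_add_right sum.distrib case_prod_unfold)
    thus ?case using m2 by (simp add: lin) (auto simp: poly_eq_iff algebra_simps)
  next
    case 3
    have "(\<Sum>(a, b, c)\<in>comps3 w. smult (3 ^ (a - 1) * 2 ^ (b - 1))
          (zeta_sh [(a, False), (b, True), (c, True)] + zeta_sh [(a, False), (b, False), (c, True)]
           + zc [(a, True), (b, True), (c, False)])) =
        weighted_zeta_sh w False True False + weighted_zeta_sh w False False True + weighted_zeta_sh w True False False"
      unfolding weighted_zeta_sh_def[of w False] weighted_zeta_sh_True
      by (simp add: smult_add_right sum.distrib case_prod_unfold)
    thus ?case using m3 by (simp add: lin) (auto simp: poly_eq_iff algebra_simps)
  next
    case 4
    have "(\<Sum>(a, b, c)\<in>comps3 w. smult (3 ^ (a - 1) * 2 ^ (b - 1)) (zc [(a, True), (b, False), (c, False)])) =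
        weighted_zeta_sh w True True True"
      by (simp add: weighted_zeta_sh_True)
    moreover have "coeff (6 * weighted_zeta_sh w True True True) n =
        coeff (3 * stuffle_term zeta_st u True True True True + of_nat (v choose 2) * zeta_st [(w, True)]) n" for n
      by (simp only: m4)
    ultimately show ?case
      by (intro poly_eqI) (simp add: lin, simp add: w field_simps)
  qed
qed

end
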